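(* Let $m\ge 2$ and let $\mathcal{A}\in\mathbb{S}_{m,n}$ have all entries nonnegative. If one of the following holds: (i) $\mathcal{A}$ is diagonally dominant; (ii) $\mathcal{A}$ is generalized diagonally dominant; (iii) $\mathcal{A}$ is an H-tensor; (iv) $\mathcal{A}$ is a complete Hankel tensor; (v) $\mathcal{A}$ is a strong Hankel tensor; (vi) $\mathcal{A}$ is an $MB_0$-tensor; (vii) $\mathcal{A}$ is the signless Laplacian tensor of an $m$-uniform hypergraph; then $\mathcal{A}$ is doubly nonnegative. (This holds for both even and odd $m$.)
   Context: $[n]=\{1,\dots,n\}$; $\mathbb{T}_{m,n}$ is the space of real $m$th order $n$-dimensional tensors $\mathcal{A}=(a_{i_1\ldots i_m})$ and $\mathbb{S}_{m,n}$ its subspace of symmetric tensors. For $x\in\mathbb{R}^n$: $x^m$ has entries $x_{i_1}\cdots x_{i_m}$; $(\mathcal{A}x^{m-1})_i=\sum_{i_2,\dots,i_m}a_{ii_2\ldots i_m}x_{i_2}\cdots x_{i_m}$; $x^{[m-1]}$ has entries $x_i^{m-1}$. A complex number $\lambda$ is an eigenvalue of $\mathcal{A}$ if $\mathcal{A}x^{m-1}=\lambda x^{[m-1]}$ for some $x\in\mathbb{C}^n\setminus\{0\}$; it is an H-eigenvalue if $\lambda$ and $x$ can be taken real. $\mathcal{A}\in\mathbb{S}_{m,n}$ is doubly nonnegative if all entries and all H-eigenvalues are nonnegative. Definitions: $\mathcal{A}$ is diagonally dominant if $|a_{i\ldots i}|\ge\sum_{(i_2,\dots,i_m)\ne(i,\dots,i)}|a_{ii_2\ldots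 i_m}|$ for all $i\in[n]$. For a positive diagonal matrix $D=\mathrm{diag}(d_1,\dots,d_n)$, $\mathcal{A}D^{1-m}D\cdots D$ denotes the tensor with entries $a_{i_1\ldots i_m}d_{i_1}^{1-m}d_{i_2}\cdots d_{i_m}$; $\mathcal{A}$ is generalized diagonally dominant if this tensor is diagonally dominant for some positive diagonal $D$. $\mathcal{I}$ is the tensor with $a_{i\ldots i}=1$ and other entries $0$; the spectral radius $\rho(\mathcal{B})$ is the maximum modulus of eigenvalues of $\mathcal{B}$. A Z-tensor is $s\mathcal{I}-\mathcal{B}$ with $\mathcal{B}$ entrywise nonnegative and $s\in\mathbb{R}$; it is an M-tensor if $s\ge\rho(\mathcal{B})$ (strong M-tensor if $s>\rho(\mathcal{B})$). The comparison tensor $M(\mathcal{A})$ has entries $|a_{i\ldots i}|$ on the diagonal and $-|a_{i_1\ldots i_m}|$ off the diagonal; $\mathcal{A}$ is an H-tensor if $M(\mathcal{A})$ is an M-tensor. $\mathcal{A}$ is a Hankel tensor if there is $v=(v_0,\dots,v_{(n-1)m})$ with $a_{i_1\ldots i_m}=v_{i_1+\dots+i_m-m}$ for all indices. A Hankel tensor is complete if $\mathcal{A}=\sum_{k=1}^r\alpha_k(u^{(k)})^m$ with $\alpha_k>0$ and $u^{(k)}=(1,\xi_k,\dots,\xi_k^{n-1})^T$, $\xi_k\in\mathbb{R}$. With $N=\lceil((n-1)m+2)/2\rceil$, a Hankel tensor is strong if the $N\times N$ Hankel matrix with $(i,j)$ entry $v_{i+j-2}$ is positive semidefinite (when $(n-1)m$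 is odd, the entry $v_{(n-1)m+1}$ is an additional number that may be chosen). For $i\in[n]$, $\beta_i(\mathcal{A})=\max\{0,\max_{(j_2,\dots,j_m)\ne(i,\dots,i)}a_{ij_2\ldots j_m}\}$; $\mathcal{A}$ is an $MB_0$-tensor if the tensor with entries $a_{i_1\ldots i_m}-\beta_{i_1}(\mathcal{A})$ is an M-tensor. For an $m$-uniform hypergraph $G=(V,E)$ with $V=[n]$ (each edge a set of $m$ distinct vertices), the adjacency tensor has entries $a_{i_1\ldots i_m}=1/(m-1)!$ if $\{i_1,\dots,i_m\}\in E$ and $0$ otherwise; the degree tensor $\mathcal{D}$ is diagonal with $d_{i\ldots i}$ the degree of vertex $i$; the signless Laplacian tensor is $\mathcal{D}+$ (adjacency tensor). *)

theory Defs
  imports Complex_Main "HOL-Library.Multiset"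
begin

text \<open>Tensors of order m and dimension n are functions on index lists of length m
  with entries in {..<n} (0-based indices). Vectors are functions on {..<n}.\<close>

type_synonym tensor = "nat list \<Rightarrow> real"

definition idx :: "nat \<Rightarrow> nat \<Rightarrow> nat list set" where
  "idx k n = {xs. length xs = k \<and> set xs \<subseteq> {..<n}}"

definition is_symmetric :: "nat \<Rightarrow> nat \<Rightarrow> tensor \<Rightarrow> bool" where
  "is_symmetric m n A \<longleftrightarrow>
     (\<forall>xs\<in>idx m n. \<forall>ys. mset ys = mset xs \<longrightarrow> A ys = A xs)"

definition nonneg_tensor :: "nat \<Rightarrow> nat \<Rightarrow> tensor \<Rightarrow> bool" where
  "nonneg_tensor m n A \<longleftrightarrow> (\<forall>xs\<in>idx m n. A xs \<ge> 0)"

definition tapply :: "nat \<Rightarrow> nat \<Rightarrow> tensor \<Rightarrow> (nat \<Rightarrow> 'a::real_algebra_1) \<Rightarrow> nat \<Rightarrow> 'a" where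
  "tapply m n A x i = (\<Sum>js\<in>idx (m - 1) n. of_real (A (i # js)) * prod_list (map x js))"

definition is_eigenvalue :: "nat \<Rightarrow> nat \<Rightarrow> tensor \<Rightarrow> complex \<Rightarrow> bool" where
  "is_eigenvalue m n A lam \<longleftrightarrow>
     (\<exists>x :: nat \<Rightarrow> complex. (\<exists>i<n. x i \<noteq> 0) \<and>
        (\<forall>i<n. tapply m n A x i = lam * x i ^ (m - 1)))"

definition is_H_eigenvalue :: "nat \<Rightarrow> nat \<Rightarrow> tensor \<Rightarrow> real \<Rightarrow> bool" where
  "is_H_eigenvalue m n A lam \<longleftrightarrow>
     (\<exists>x :: nat \<Rightarrow> real. (\<exists>i<n. x i \<noteq> 0) \<and>
        (\<forall>i<n. tapply m n A x i = lam * x i ^ (m - 1)))"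

definition doubly_nonnegative :: "nat \<Rightarrow> nat \<Rightarrow> tensor \<Rightarrow> bool" where
  "doubly_nonnegative m n A \<longleftrightarrow> is_symmetric m n A \<and> nonneg_tensor m n A \<and>
     (\<forall>lam. is_H_eigenvalue m n A lam \<longrightarrow> lam \<ge> 0)"

definition is_diag_index :: "nat list \<Rightarrow> bool" where
  "is_diag_index xs \<longleftrightarrow> xs = replicate (length xs) (hd xs)"

definition diagonally_dominant :: "nat \<Rightarrow> nat \<Rightarrow> tensor \<Rightarrow> bool" where
  "diagonally_dominant m n A \<longleftrightarrow>
     (\<forall>i<n. \<bar>A (replicate m i)\<bar> \<ge>
        (\<Sum>js\<in>idx (m - 1) n - {replicate (m - 1) i}. \<bar>A (i # js)\<bar>))"

definition gen_diagonally_dominant :: "nat \<Rightarrow> nat \<Rightarrow> tensor \<Rightarrow> bool" where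
  "gen_diagonally_dominant m n A \<longleftrightarrow>
     (\<exists>d :: nat \<Rightarrow> real. (\<forall>i<n. d i > 0) \<and>
        diagonally_dominant m n
          (\<lambda>xs. A xs * inverse (d (hd xs) ^ (m - 1)) * prod_list (map d (tl xs))))"

definition unit_tensor :: tensor where
  "unit_tensor xs = (if is_diag_index xs then 1 else 0)"

definition tensor_spectral_radius :: "nat \<Rightarrow> nat \<Rightarrow> tensor \<Rightarrow> real" where
  "tensor_spectral_radius m n B = Sup (cmod ` {lam. is_eigenvalue m n B lam})"

definition is_M_tensor :: "nat \<Rightarrow> nat \<Rightarrow> tensor \<Rightarrow> bool" where
  "is_M_tensor m n A \<longleftrightarrow>
     (\<exists>s B. nonneg_tensor m n B \<and> (\<forall>xs\<in>idx m n. A xs = s * unit_tensor xs - B xs) \<and>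
        s \<ge> tensor_spectral_radius m n B)"

definition comparison_tensor :: "tensor \<Rightarrow> tensor" where
  "comparison_tensor A xs = (if is_diag_index xs then \<bar>A xs\<bar> else - \<bar>A xs\<bar>)"

definition is_H_tensor :: "nat \<Rightarrow> nat \<Rightarrow> tensor \<Rightarrow> bool" where
  "is_H_tensor m n A \<longleftrightarrow> is_M_tensor m n (comparison_tensor A)"

definition hankel_generator :: "nat \<Rightarrow> nat \<Rightarrow> tensor \<Rightarrow> (nat \<Rightarrow> real) \<Rightarrow> bool" where
  "hankel_generator m n A v \<longleftrightarrow> (\<forall>xs\<in>idx m n. A xs = v (sum_list xs))"

definition is_Hankel :: "nat \<Rightarrow> nat \<Rightarrow> tensor \<Rightarrow> bool" where
  "is_Hankel m n A \<longleftrightarrow> (\<exists>v. hankel_generator m n A v)"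

definition complete_Hankel :: "nat \<Rightarrow> nat \<Rightarrow> tensor \<Rightarrow> bool" where
  "complete_Hankel m n A \<longleftrightarrow> is_Hankel m n A \<and>
     (\<exists>(r::nat) (\<alpha>::nat \<Rightarrow> real) (\<xi>::nat \<Rightarrow> real). (\<forall>k<r. \<alpha> k > 0) \<and>
        (\<forall>xs\<in>idx m n. A xs = (\<Sum>k<r. \<alpha> k * prod_list (map (\<lambda>i. \<xi> k ^ i) xs))))"

text \<open>N = ceil(((n-1)m+2)/2); the Hankel matrix (v_{i+j})_{i,j<N} is PSD. When (n-1)m is odd
  the entry v_{(n-1)m+1} is free, which is captured by quantifying existentially over v.\<close>
definition strong_Hankel :: "nat \<Rightarrow> nat \<Rightarrow> tensor \<Rightarrow> bool" where
  "strong_Hankel m n A \<longleftrightarrow>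
     (\<exists>v. hankel_generator m n A v \<and>
        (let N = ((n - 1) * m + 3) div 2 in
          \<forall>y :: nat \<Rightarrow> real. (\<Sum>i<N. \<Sum>j<N. v (i + j) * y i * y j) \<ge> 0))"

definition beta_MB :: "nat \<Rightarrow> nat \<Rightarrow> tensor \<Rightarrow> nat \<Rightarrow> real" where
  "beta_MB m n A i = Max (insert 0 ((\<lambda>js. A (i # js)) ` (idx (m - 1) n - {replicate (m - 1) i})))"

definition is_MB0_tensor :: "nat \<Rightarrow> nat \<Rightarrow> tensor \<Rightarrow> bool" where
  "is_MB0_tensor m n A \<longleftrightarrow> is_M_tensor m n (\<lambda>xs. A xs - beta_MB m n A (hd xs))"

definition uniform_hypergraph :: "nat \<Rightarrow> nat \<Rightarrow> nat set set \<Rightarrow> bool" where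
  "uniform_hypergraph m n E \<longleftrightarrow> (\<forall>e\<in>E. e \<subseteq> {..<n} \<and> card e = m)"

definition hyper_degree :: "nat set set \<Rightarrow> nat \<Rightarrow> nat" where
  "hyper_degree E i = card {e\<in>E. i \<in> e}"

definition signless_laplacian :: "nat \<Rightarrow> nat set set \<Rightarrow> tensor" where
  "signless_laplacian m E xs =
     (if is_diag_index xs then real (hyper_degree E (hd xs)) else 0)
     + (if set xs \<in> E then 1 / fact (m - 1) else 0)"

definition is_signless_laplacian_of_hypergraph :: "nat \<Rightarrow> nat \<Rightarrow> tensor \<Rightarrow> bool" where
  "is_signless_laplacian_of_hypergraph m n A \<longleftrightarrow>
     (\<exists>E. uniform_hypergraph m n E \<and> (\<forall>xs\<in>idx m n. A xs = signless_laplacian m E xs))"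

end

(*
Scaling by a positive vector d and looking at a component where |x_i| / d_i is maximal shows that a
generalized diagonally dominant nonnegative tensor has no negative H-eigenvalue.  For H-tensors and
MB_0-tensors one needs such a d for s I - B with s > rho(B): the equation s d^[m-1] = 1 + B d^(m-1)
is solvable for large s, and at the infimum of the solvable s its normalised solutions
converge to an eigenvector of B, so that this infimum is at most rho(B).  An MB_0-tensor is handled
for odd m by d directly, and for even m through its quadratic-form analogue, after subtracting the
positive semidefinite tensor with entries min(beta_(i_1), ..., beta_(i_m)).  Hankel tensors are
treated through the functional t^a |-> v_a on polynomials, which is nonnegative on squares.
*)
theory Submission
  imports Defs "HOL-Analysis.Analysis" "HOL-Combinatorics.Multiset_Permutations"
begin

section \<open>Sums over index lists\<close>

text \<open>The M-tensor conditions speak only of rho(B), a supremum over complex eigenvalues, while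
  the row arguments need a positive \<open>d\<close> with B d^(m-1) \<le> s d^[m-1]. At s = rho(B)
  such a \<open>d\<close> can fail to exist: the 2 x 2 matrix with a single off-diagonal entry 1 and
  zeros elsewhere has rho = 0. For H- and MB_0-tensors the bounds are therefore proved in the form
  \<open>- e \<le> lam\<close> for every \<open>e > 0\<close>. The constant 1 in the inhomogeneous
  equation is what forces every component of a solution to be positive. For even m its sign is
  unknown, and the tensor with entries beta_(i_1) need not be symmetric; hence the passage to the
  form A x^m and to a symmetric replacement. Cases (i) and (vii) reduce to (ii), and case (iv)
  reduces to (v).\<close>

lemma finite_idx [simp]: "finite (idx k n)"
  using finite_lists_length_eq[of "{..<n}" k] by (simp add: idx_def conj_commute)

lemma idx_0 [simp]: "idx 0 n = {[]}"
  by (auto simp: idx_def)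

lemma Cons_in_idx_iff [simp]: "i # js \<in> idx (Suc k) n \<longleftrightarrow> i < n \<and> js \<in> idx k n"
  by (auto simp: idx_def)

lemma replicate_in_idx: "i < n \<Longrightarrow> replicate k i \<in> idx k n"
  by (auto simp: idx_def)

lemma replicate_eq_Cons_pred: "m \<ge> 1 \<Longrightarrow> replicate m i = i # replicate (m - 1) i"
  by (cases m) auto

lemma length_idx: "xs \<in> idx k n \<Longrightarrow> length xs = k"
  by (simp add: idx_def)

lemma set_idx: "xs \<in> idx k n \<Longrightarrow> set xs \<subseteq> {..<n}"
  by (simp add: idx_def)

lemma sum_idx_Suc: "(\<Sum>xs\<in>idx (Suc k) n. f xs) = (\<Sum>i<n. \<Sum>js\<in>idx k n. f (i # js))"
proof -
  have "idx (Suc k) n = (\<lambda>(i, js). i # js) ` ({..<n} \<times> idx k n)"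
    by (auto simp: idx_def image_iff length_Suc_conv)
  moreover have "inj_on (\<lambda>(i, js). i # js) ({..<n} \<times> idx k n)"
    by (auto simp: inj_on_def)
  ultimately show ?thesis
    by (simp add: sum.reindex sum.cartesian_product case_prod_unfold)
qed

lemma sum_idx_add:
  "(\<Sum>xs\<in>idx (a + b) n. f xs) = (\<Sum>js\<in>idx a n. \<Sum>ls\<in>idx b n. f (js @ ls))"
  by (induction a arbitrary: f) (simp_all add: sum_idx_Suc)

lemma sum_prod_list_idx:
  fixes g :: "nat \<Rightarrow> 'a::comm_semiring_1"
  shows "(\<Sum>xs\<in>idx k n. prod_list (map g xs)) = (\<Sum>i<n. g i) ^ k"
  by (induction k) (simp_all add: sum_idx_Suc sum_distrib_right flip: sum_distrib_left)

lemma prod_list_map_nonneg: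
  fixes x :: "nat \<Rightarrow> real"
  assumes "\<And>i. i \<in> set js \<Longrightarrow> 0 \<le> x i"
  shows "0 \<le> prod_list (map x js)"
  using assms by (induction js) auto

lemma prod_list_map_mono:
  fixes x y :: "nat \<Rightarrow> real"
  assumes "\<And>i. i \<in> set js \<Longrightarrow> 0 \<le> x i \<and> x i \<le> y i"
  shows "prod_list (map x js) \<le> prod_list (map y js)"
  using assms
proof (induction js)
  case (Cons a js)
  then show ?case
    using order_trans by (auto intro!: mult_mono prod_list_map_nonneg)
qed simp

lemma norm_prod_list_map:
  fixes x :: "nat \<Rightarrow> 'a::real_normed_div_algebra"
  shows "norm (prod_list (map x js)) = prod_list (map (\<lambda>i. norm (x i)) js)"
  by (induction js) (simp_all add: norm_mult)

lemma prod_list_map_mult: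
  fixes x y :: "nat \<Rightarrow> 'a::comm_monoid_mult"
  shows "prod_list (map (\<lambda>i. x i * y i) js) = prod_list (map x js) * prod_list (map y js)"
  by (induction js) (simp_all add: ac_simps)

lemma prod_list_map_scale:
  fixes c :: "'a::comm_monoid_mult"
  shows "prod_list (map (\<lambda>i. c * x i) js) = c ^ length js * prod_list (map x js)"
  by (induction js) (simp_all add: ac_simps)

section \<open>Generalized diagonal dominance\<close>

lemma tapply_real:
  "tapply m n A (x :: nat \<Rightarrow> real) i = (\<Sum>js\<in>idx (m - 1) n. A (i # js) * prod_list (map x js))"
  by (simp add: tapply_def)

lemma tapply_scale:
  "tapply m n A (\<lambda>i. c * x i) i = c ^ (m - 1) * tapply m n A (x :: nat \<Rightarrow> real) i"
  by (simp add: tapply_real prod_list_map_scale length_idx sum_distrib_left ac_simps)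

lemma nonneg_tensor_Cons:
  assumes "nonneg_tensor m n B" "m \<ge> 1" "i < n" "js \<in> idx (m - 1) n"
  shows "0 \<le> B (i # js)"
  using assms Cons_in_idx_iff[of i js "m - 1" n] by (simp add: nonneg_tensor_def)

lemma tapply_nonneg:
  assumes "nonneg_tensor m n B" "m \<ge> 1" "i < n" "\<And>i. i < n \<Longrightarrow> 0 \<le> (x i :: real)"
  shows "0 \<le> tapply m n B x i"
  unfolding tapply_real using assms(4) set_idx
  by (intro sum_nonneg mult_nonneg_nonneg prod_list_map_nonneg nonneg_tensor_Cons[OF assms(1-3)]) blast+

lemma tapply_mono:
  assumes "nonneg_tensor m n B" "m \<ge> 1" "i < n" "\<And>i. i < n \<Longrightarrow> 0 \<le> x i \<and> x i \<le> (y i :: real)"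
  shows "tapply m n B x i \<le> tapply m n B y i"
  unfolding tapply_real using assms(4) set_idx
  by (intro sum_mono mult_left_mono prod_list_map_mono nonneg_tensor_Cons[OF assms(1-3)]) blast+

lemma norm_tapply_le:
  fixes x :: "nat \<Rightarrow> 'a::real_normed_field"
  assumes "nonneg_tensor m n B" "m \<ge> 1" "i < n"
  shows "norm (tapply m n B x i) \<le> tapply m n B (\<lambda>i. norm (x i)) i"
  unfolding tapply_real tapply_def[of m n B x i]
  by (rule order_trans[OF norm_sum], rule sum_mono)
     (use assms in \<open>auto simp: norm_mult norm_prod_list_map nonneg_tensor_Cons\<close>)

text \<open>At the index of maximal ratio \<open>r i\<close>, all of \<open>x\<close> lies below
  \<open>r i * d\<close> in norm, with equality at \<open>i\<close>; monotonicity and homogeneity do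
  the rest. The field is left general so that real H-eigenvectors and complex eigenvectors are both
  covered, and \<open>c\<close> varies with the row so that it can absorb diagonal entries or row
  sums.\<close>

lemma tapply_le_of_max_ratio:
  fixes x :: "nat \<Rightarrow> 'a::real_normed_field"
  assumes B: "nonneg_tensor m n B" "m \<ge> 1"
    and d: "\<And>i. i < n \<Longrightarrow> 0 < d i"
    and c: "\<And>i. i < n \<Longrightarrow> tapply m n B d i \<le> c i * d i ^ (m - 1)"
    and x: "j < n" "x j \<noteq> 0"
  obtains i where "i < n" "x i \<noteq> 0" "norm (tapply m n B x i) \<le> c i * norm (x i) ^ (m - 1)"
proof -
  define r where "r i = norm (x i) / d i" for i
  obtain i where i: "i < n" "\<And>l. l < n \<Longrightarrow> r l \<le> r i"
    using Max_in[of "r ` {..<n}"] Max_ge[of "r ` {..<n}"] x by fastforce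
  have "0 < r j" using x d by (simp add: r_def)
  then have ri: "0 < r i" using i(2)[OF x(1)] by simp
  have xi: "norm (x i) = r i * d i" using d[OF i(1)] by (simp add: r_def)
  have le: "norm (x l) \<le> r i * d l" if "l < n" for l
    using i(2)[OF that] d[OF that] by (simp add: r_def pos_divide_le_eq)
  have "norm (tapply m n B x i) \<le> tapply m n B (\<lambda>i. norm (x i)) i"
    using B i by (intro norm_tapply_le)
  also have "\<dots> \<le> tapply m n B (\<lambda>l. r i * d l) i"
    using B i le by (intro tapply_mono) auto
  also have "\<dots> = r i ^ (m - 1) * tapply m n B d i"
    by (rule tapply_scale)
  also have "\<dots> \<le> r i ^ (m - 1) * (c i * d i ^ (m - 1))"
    using ri c[OF i(1)] by (intro mult_left_mono) auto
  also have "\<dots> = c i * norm (x i) ^ (m - 1)"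
    by (simp add: xi power_mult_distrib)
  finally have le: "norm (tapply m n B x i) \<le> c i * norm (x i) ^ (m - 1)" .
  have "x i \<noteq> 0" using ri by (auto simp: r_def)
  from that[OF i(1) this le] show ?thesis .
qed

lemma is_diag_index_Cons: "is_diag_index (i # js) \<longleftrightarrow> js = replicate (length js) i"
  by (simp add: is_diag_index_def)

lemma tapply_split_diag:
  assumes "i < n"
  shows "tapply m n A (x :: nat \<Rightarrow> real) i = A (i # replicate (m - 1) i) * x i ^ (m - 1)
     + (\<Sum>js\<in>idx (m - 1) n - {replicate (m - 1) i}. A (i # js) * prod_list (map x js))"
  unfolding tapply_real
  by (subst sum.remove[of _ "replicate (m - 1) i"])
     (use assms in \<open>auto simp: replicate_in_idx prod_list_replicate\<close>)

text \<open>A Gershgorin argument: with the diagonal removed from \<open>A\<close>, the eigenvalue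
  equation at a component of maximal ratio gives |lam - a_ii| \<le> a_ii + e. Only norms of powers
  are compared, so the parity of \<open>m\<close> does not matter.\<close>

lemma H_eigenvalue_ge_of_scaled_dominance:
  assumes A: "nonneg_tensor m n A" and m: "m \<ge> 1"
    and d: "\<And>i. i < n \<Longrightarrow> 0 < d i"
    and dom: "\<And>i. i < n \<Longrightarrow>
      (\<Sum>js\<in>idx (m - 1) n - {replicate (m - 1) i}. A (i # js) * prod_list (map d js))
        \<le> (A (replicate m i) + e) * d i ^ (m - 1)"
    and lam: "is_H_eigenvalue m n A lam"
  shows "- e \<le> lam"
proof -
  define B where "B xs = (if is_diag_index xs then 0 else A xs)" for xs
  have B: "nonneg_tensor m n B" using A by (simp add: nonneg_tensor_def B_def)
  note rep = replicate_eq_Cons_pred[OF m]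
  have Bapply: "tapply m n B x i =
      (\<Sum>js\<in>idx (m - 1) n - {replicate (m - 1) i}. A (i # js) * prod_list (map x js))"
    if "i < n" for x :: "nat \<Rightarrow> real" and i
  proof -
    have "B (i # js) = (if js = replicate (m - 1) i then 0 else A (i # js))"
      if "js \<in> idx (m - 1) n" for js
      using that by (simp add: B_def is_diag_index_Cons length_idx)
    then show ?thesis
      using that by (simp add: tapply_split_diag replicate_in_idx)
  qed
  obtain x j where x: "j < n" "x j \<noteq> (0::real)"
    and eig: "\<And>i. i < n \<Longrightarrow> tapply m n A x i = lam * x i ^ (m - 1)"
    using lam by (auto simp: is_H_eigenvalue_def)
  have Bd: "tapply m n B d i \<le> (A (replicate m i) + e) * d i ^ (m - 1)" if "i < n" for i
    using dom[OF that] Bapply[OF that] by simp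
  obtain i where i: "i < n" "x i \<noteq> 0"
    and le: "norm (tapply m n B x i) \<le> (A (replicate m i) + e) * norm (x i) ^ (m - 1)"
    using tapply_le_of_max_ratio[where B = B and d = d and x = x and j = j and m = m and n = n
        and c = "\<lambda>i. A (replicate m i) + e", OF B m] d Bd x
    by blast
  have "tapply m n B x i = (lam - A (replicate m i)) * x i ^ (m - 1)"
    using eig[OF i(1)] tapply_split_diag[OF i(1), of m A x] Bapply[OF i(1), of x]
    by (simp add: rep algebra_simps)
  then have "\<bar>lam - A (replicate m i)\<bar> * \<bar>x i\<bar> ^ (m - 1) \<le> (A (replicate m i) + e) * \<bar>x i\<bar> ^ (m - 1)"
    using le by (simp add: abs_mult power_abs)
  then have "\<bar>lam - A (replicate m i)\<bar> \<le> A (replicate m i) + e"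
    using i(2) by (simp add: mult_le_cancel_right)
  then show ?thesis by simp
qed

lemma gen_diagonally_dominant_H_eigenvalue_nonneg:
  assumes A: "nonneg_tensor m n A" and m: "m \<ge> 1"
    and gdd: "gen_diagonally_dominant m n A" and lam: "is_H_eigenvalue m n A lam"
  shows "0 \<le> lam"
proof -
  note rep = replicate_eq_Cons_pred[OF m]
  obtain d where d: "\<And>i. i < n \<Longrightarrow> 0 < d i"
    and dd: "diagonally_dominant m n
          (\<lambda>xs. A xs * inverse (d (hd xs) ^ (m - 1)) * prod_list (map d (tl xs)))"
    using gdd by (auto simp: gen_diagonally_dominant_def)
  have "(\<Sum>js\<in>idx (m - 1) n - {replicate (m - 1) i}. A (i # js) * prod_list (map d js))
        \<le> (A (replicate m i) + 0) * d i ^ (m - 1)" if i: "i < n" for i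
  proof -
    have nn: "0 \<le> A (i # js) * inverse (d i ^ (m - 1)) * prod_list (map d js)"
      if "js \<in> idx (m - 1) n" for js
      using nonneg_tensor_Cons[OF A m i that] d i set_idx[OF that]
      by (intro mult_nonneg_nonneg prod_list_map_nonneg) (auto intro!: less_imp_le)
    have abs: "\<bar>A (i # js) * inverse (d i ^ (m - 1)) * prod_list (map d js)\<bar>
        = A (i # js) * prod_list (map d js) / d i ^ (m - 1)" if "js \<in> idx (m - 1) n" for js
      using nn[OF that] by (simp add: divide_inverse mult.assoc mult.commute)
    have "(\<Sum>js\<in>idx (m - 1) n - {replicate (m - 1) i}.
        \<bar>A (i # js) * inverse (d i ^ (m - 1)) * prod_list (map d js)\<bar>)
        \<le> \<bar>A (i # replicate (m - 1) i) * inverse (d i ^ (m - 1)) * prod_list (map d (replicate (m - 1) i))\<bar>"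
      using dd i unfolding diagonally_dominant_def rep by simp
    also have "\<dots> = A (i # replicate (m - 1) i)"
      using nn[OF replicate_in_idx[OF i]] d[OF i] by (simp add: prod_list_replicate)
    also have "(\<Sum>js\<in>idx (m - 1) n - {replicate (m - 1) i}.
        \<bar>A (i # js) * inverse (d i ^ (m - 1)) * prod_list (map d js)\<bar>) =
        (\<Sum>js\<in>idx (m - 1) n - {replicate (m - 1) i}. A (i # js) * prod_list (map d js)) / d i ^ (m - 1)"
      unfolding sum_divide_distrib using abs by (intro sum.cong) auto
    finally show ?thesis using d[OF i] by (simp add: pos_divide_le_eq rep)
  qed
  from H_eigenvalue_ge_of_scaled_dominance[OF A m d this lam] show ?thesis by simp
qed

lemma diagonally_dominant_imp_gen:
  "diagonally_dominant m n A \<Longrightarrow> gen_diagonally_dominant m n A"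
  unfolding gen_diagonally_dominant_def by (rule exI[of _ "\<lambda>_. 1"]) (simp add: map_replicate_const prod_list_replicate)

section \<open>Dominating vectors above the spectral radius\<close>

text \<open>Vectors are functions on \<open>nat\<close> controlled only below \<open>n\<close>, so
  Bolzano-Weierstrass for real sequences is applied one coordinate at a time, refining the
  subsequence.\<close>

lemma pointwise_convergent_subsequence:
  fixes X :: "nat \<Rightarrow> nat \<Rightarrow> real"
  assumes "\<And>k i. i < n \<Longrightarrow> \<bar>X k i\<bar> \<le> C"
  shows "\<exists>r x. strict_mono r \<and> (\<forall>i<n. (\<lambda>k. X (r k) i) \<longlonglongrightarrow> x i)"
  using assms
proof (induction n)
  case 0
  then show ?case by (intro exI[of _ "\<lambda>k. k"]) (auto simp: strict_mono_def)
next
  case (Suc n)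
  then obtain r x where r: "strict_mono (r :: nat \<Rightarrow> nat)" "\<And>i. i < n \<Longrightarrow> (\<lambda>k. X (r k) i) \<longlonglongrightarrow> x i"
    by fastforce
  have "bounded (range (\<lambda>k. X (r k) n))"
    using Suc.prems by (auto simp: bounded_iff)
  then obtain l s where s: "strict_mono (s :: nat \<Rightarrow> nat)" "((\<lambda>k. X (r k) n) \<circ> s) \<longlonglongrightarrow> l"
    using bounded_imp_convergent_subsequence by blast
  have "(\<lambda>k. X ((r \<circ> s) k) i) \<longlonglongrightarrow> (x(n := l)) i" if "i < Suc n" for i
  proof (cases "i = n")
    case False
    then show ?thesis using LIMSEQ_subseq_LIMSEQ[OF r(2) s(1), of i] that by (simp add: o_def)
  qed (use s(2) in \<open>simp add: o_def\<close>)
  then show ?case using strict_mono_o[OF r(1) s(1)] by blast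
qed

lemma tendsto_tapply:
  fixes X :: "nat \<Rightarrow> nat \<Rightarrow> real"
  assumes X: "\<And>i. i < n \<Longrightarrow> (\<lambda>k. X k i) \<longlonglongrightarrow> x i"
  shows "(\<lambda>k. tapply m n B (X k) i) \<longlonglongrightarrow> tapply m n B x i"
proof -
  have "(\<lambda>k. prod_list (map (X k) js)) \<longlonglongrightarrow> prod_list (map x js)" if "set js \<subseteq> {..<n}" for js
    using that by (induction js) (auto intro!: tendsto_mult X)
  then show ?thesis
    unfolding tapply_real using set_idx by (intro tendsto_sum tendsto_mult) auto
qed

text \<open>The infimum of all supersolutions is again a supersolution, and applying the fixed-point
  map to it cannot make it smaller.\<close>
lemma exact_solution_of_supersolution:
  assumes B: "nonneg_tensor m n B" and m: "m \<ge> 2" and t: "0 < t"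
    and D: "\<And>i. i < n \<Longrightarrow> 0 \<le> D i" "\<And>i. i < n \<Longrightarrow> 1 + tapply m n B D i \<le> t * D i ^ (m - 1)"
  obtains d :: "nat \<Rightarrow> real" where "\<And>i. i < n \<Longrightarrow> 0 < d i"
    "\<And>i. i < n \<Longrightarrow> t * d i ^ (m - 1) = 1 + tapply m n B d i"
proof -
  \<comment> \<open>Nonnegativity is demanded at every index, also beyond \<open>n\<close>, so that
    each infimum \<open>d i\<close> is taken over a set bounded below. The given \<open>D\<close>
    therefore enters \<open>S\<close> only after truncation to 0 beyond \<open>n\<close>.\<close>
  define S where "S = {e :: nat \<Rightarrow> real. (\<forall>i. 0 \<le> e i) \<and>
      (\<forall>i<n. 1 + tapply m n B e i \<le> t * e i ^ (m - 1))}"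
  have m1: "m \<ge> 1" "m - 1 > 0" using m by auto
  have cong: "tapply m n B (\<lambda>j. if j < n then f j else 0) i = tapply m n B f i"
    if "i < n" for i and f :: "nat \<Rightarrow> real"
    unfolding tapply_real using set_idx
    by (intro sum.cong arg_cong2[of _ _ _ _ "(*)"] arg_cong[of _ _ prod_list] map_cong refl) auto
  have "(\<lambda>j. if j < n then D j else 0) \<in> S"
    using D by (simp add: S_def cong)
  then have ne: "S \<noteq> {}" by auto
  define d where "d i = (INF e\<in>S. e i)" for i
  have bdd: "bdd_below ((\<lambda>e. e i) ` S)" for i
    by (rule bdd_belowI[of _ 0]) (auto simp: S_def)
  have d0: "0 \<le> d i" for i
    unfolding d_def by (rule cINF_greatest[OF ne]) (simp add: S_def)
  have dle: "d i \<le> e i" if "e \<in> S" for e i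
    unfolding d_def by (rule cINF_lower[OF bdd that])
  have Fd0: "0 \<le> tapply m n B d i" if "i < n" for i
    using B m1(1) that d0 by (intro tapply_nonneg) auto
  define d' where "d' i = (if i < n then root (m - 1) ((1 + tapply m n B d i) / t) else 0)" for i
  have d'0: "0 \<le> d' i" for i
    using Fd0[of i] t by (auto simp: d'_def intro!: real_root_ge_zero divide_nonneg_pos)
  have d'pow: "t * d' i ^ (m - 1) = 1 + tapply m n B d i" if "i < n" for i
    using Fd0[OF that] t m1 that by (simp add: d'_def)
  have d'le: "d' i \<le> d i" for i
    unfolding d_def
  proof (rule cINF_greatest[OF ne])
    fix e assume e: "e \<in> S"
    show "d' i \<le> e i"
    proof (cases "i < n")
      case True
      have "t * d' i ^ (m - 1) \<le> 1 + tapply m n B e i"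
        using tapply_mono[OF B m1(1) True, of d e] d0 dle[OF e] d'pow[OF True] by simp
      also have "\<dots> \<le> t * e i ^ (m - 1)" using e True by (simp add: S_def)
      finally have "d' i ^ (m - 1) \<le> e i ^ (m - 1)" using t by simp
      then show ?thesis
        using e m1 d'0[of i] power_mono_iff[of "d' i" "e i" "m - 1"] by (simp add: S_def)
    qed (use e in \<open>auto simp: d'_def S_def\<close>)
  qed
  \<comment> \<open>From \<open>d'\<close> \<le> \<open>d\<close> follows 1 + B d' \<le> 1 + B d,
    which is t d'^(m-1): the image is a supersolution too, and minimality of \<open>d\<close> then
    gives equality.\<close>
  have "d' \<in> S"
    using d'0 d'le d'pow tapply_mono[OF B m1(1), of _ d' d] by (auto simp: S_def)
  then have eq: "d i = d' i" for i
    using dle d'le by (meson antisym)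
  then have sol: "t * d i ^ (m - 1) = 1 + tapply m n B d i" if "i < n" for i
    using d'pow[OF that] by simp
  have "0 < d i" if "i < n" for i
    using sol[OF that] Fd0[OF that] d0[of i] m1 by (cases "d i = 0") (auto simp: zero_power)
  with sol that show ?thesis by blast
qed

text \<open>The number \<open>t\<close> is the infimum of those \<open>t' > 0\<close> for which \<open>t' d\<^sup>m\<^sup>-\<^sup>1 = 1 + B d\<^sup>m\<^sup>-\<^sup>1\<close> is solvable
  with \<open>d > 0\<close>: near it the solutions blow up, and normalised they converge to an eigenvector.\<close>
lemma dominating_vectors_above_eigenvalue:
  assumes B: "nonneg_tensor m n B" and m: "m \<ge> 2" and n: "0 < n"
  obtains t where "0 \<le> t" "is_eigenvalue m n B (of_real t)"
    "\<And>t'. t < t' \<Longrightarrow> \<exists>d. (\<forall>i<n. 0 < d i) \<and> (\<forall>i<n. tapply m n B d i \<le> t' * d i ^ (m - 1))"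
proof -
  have m1: "m \<ge> 1" "m - 1 > 0" using m by auto
  define sol where "sol t d \<longleftrightarrow> (\<forall>i<n. 0 < d i) \<and>
      (\<forall>i<n. t * d i ^ (m - 1) = 1 + tapply m n B d i)" for t and d :: "nat \<Rightarrow> real"
  define T where "T = {t. 0 < t \<and> (\<exists>d. sol t d)}"
  have T_super: "t \<in> T" if "0 < t" "\<And>i. i < n \<Longrightarrow> 0 \<le> D i"
    "\<And>i. i < n \<Longrightarrow> 1 + tapply m n B D i \<le> t * D i ^ (m - 1)" for t D
    by (rule exact_solution_of_supersolution[OF B m that]) (use that(1) in \<open>auto simp: T_def sol_def\<close>)
  \<comment> \<open>Exceeds 1 plus any single row sum or equals it, so the all-ones vector is a
    supersolution for \<open>R\<close>.\<close>
  define R where "R = 1 + (\<Sum>i<n. tapply m n B (\<lambda>_. 1::real) i)"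
  have nn1: "0 \<le> tapply m n B (\<lambda>_. 1::real) i" if "i < n" for i
    using tapply_nonneg[OF B m1(1) that] by simp
  have "R \<in> T"
  proof (rule T_super[where D = "\<lambda>_. 1"])
    show "0 < R" using nn1 unfolding R_def by (intro add_pos_nonneg sum_nonneg) auto
    show "1 + tapply m n B (\<lambda>_. 1::real) i \<le> R * 1 ^ (m - 1)" if "i < n" for i
      using that nn1 member_le_sum[of i "{..<n}" "\<lambda>i. tapply m n B (\<lambda>_. 1::real) i"]
      by (simp add: R_def)
  qed simp
  then have Tne: "T \<noteq> {}" by auto
  define s where "s = Inf T"
  have bdd: "bdd_below T" by (rule bdd_belowI[of _ 0]) (auto simp: T_def)
  have s0: "0 \<le> s" unfolding s_def by (rule cInf_greatest[OF Tne]) (auto simp: T_def)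
  have above: "\<exists>t\<in>T. t < t'" if "s < t'" for t'
    using that cInf_less_iff[OF Tne bdd] by (simp add: s_def)
  have blowup: "\<exists>t d. s \<le> t \<and> t < s + 1 / Suc k \<and> sol t d \<and> (\<exists>i<n. real (Suc k) < d i)" for k
  proof -
    \<comment> \<open>Chosen so that \<eta> * (k + 1)^(m-1) = 1/2. If \<open>d\<close> stayed below
      k + 1, lowering \<open>t\<close> by \<eta> would cost at most half of the constant 1, and
      \<open>t - \<eta>\<close>, which is less than \<open>s\<close>, would still be
      solvable.\<close>
    define \<eta> where "\<eta> = 1 / (2 * real (Suc k) ^ (m - 1))"
    have \<eta>: "0 < \<eta>" by (simp add: \<eta>_def)
    obtain t where t: "t \<in> T" "t < s + min (1 / Suc k) \<eta>"
      using above[of "s + min (1 / Suc k) \<eta>"] \<eta> by auto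
    then obtain d where d: "sol t d" by (auto simp: T_def)
    have dpos: "0 < d i" and deq: "t * d i ^ (m - 1) = 1 + tapply m n B d i" if "i < n" for i
      using d that by (auto simp: sol_def)
    have "\<exists>i<n. real (Suc k) < d i"
    proof (rule ccontr)
      assume "\<not> ?thesis"
      then have small: "d i \<le> real (Suc k)" if "i < n" for i using that by force
      \<comment> \<open>Both remaining terms are homogeneous of degree m - 1, so scaling
        \<open>d\<close> by \<open>c\<close> turns the constant 1/2 back into 1.\<close>
      define c where "c = root (m - 1) 2"
      have c: "0 < c" "c ^ (m - 1) = 2" using m1 by (auto simp: c_def)
      have key: "1 / 2 + tapply m n B d i \<le> (t - \<eta>) * d i ^ (m - 1)" if i: "i < n" for i
      proof -
        have "\<eta> * d i ^ (m - 1) \<le> \<eta> * real (Suc k) ^ (m - 1)"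
          using small[OF i] dpos[OF i] \<eta> by (intro mult_left_mono power_mono) auto
        also have "\<dots> = 1 / 2" by (simp add: \<eta>_def)
        finally show ?thesis using deq[OF i] by (simp add: algebra_simps)
      qed
      have "0 < (t - \<eta>) * d 0 ^ (m - 1)"
        using key[OF n] tapply_nonneg[OF B m1(1) n, of d] dpos by (fastforce intro: less_imp_le)
      then have "0 < t - \<eta>" using dpos[OF n] by (simp add: zero_less_mult_iff)
      moreover have "1 + tapply m n B (\<lambda>i. c * d i) i \<le> (t - \<eta>) * (c * d i) ^ (m - 1)" if "i < n" for i
        using key[OF that] unfolding tapply_scale power_mult_distrib c(2) by simp
      ultimately have "t - \<eta> \<in> T"
        using c dpos by (intro T_super[where D = "\<lambda>i. c * d i"]) (auto intro: less_imp_le)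
      then have "s \<le> t - \<eta>" unfolding s_def by (rule cInf_lower[OF _ bdd])
      then show False using t by simp
    qed
    moreover have "s \<le> t" unfolding s_def by (rule cInf_lower[OF t(1) bdd])
    moreover have "t < s + 1 / Suc k" using t(2) by simp
    ultimately show ?thesis using d by blast
  qed
  then have "\<forall>k. \<exists>td. s \<le> fst td \<and> fst td < s + 1 / Suc k \<and> sol (fst td) (snd td) \<and>
      (\<exists>i<n. real (Suc k) < snd td i)"
    by (metis fst_conv snd_conv)
  from choice[OF this] obtain td where td': "\<And>k. s \<le> fst (td k) \<and> fst (td k) < s + 1 / Suc k \<and>
      sol (fst (td k)) (snd (td k)) \<and> (\<exists>i<n. real (Suc k) < snd (td k) i)"
    by blast
  define t d where "t k = fst (td k)" and "d k = snd (td k)" for k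
  have td: "s \<le> t k" "t k < s + 1 / Suc k" "sol (t k) (d k)" "\<exists>i<n. real (Suc k) < d k i" for k
    using td'[of k] by (simp_all add: t_def d_def)
  \<comment> \<open>Normalising by the sum keeps the coordinates in [0, 1] and makes the limit have
    coordinate sum 1, hence nonzero.\<close>
  define p where "p k = (\<Sum>i<n. d k i)" for k
  have dpos: "0 < d k i" if "i < n" for k i using td(3) that by (auto simp: sol_def)
  have d_le_p: "d k i \<le> p k" if "i < n" for k i
    unfolding p_def using that dpos by (intro member_le_sum) (auto intro: less_imp_le)
  have p: "real (Suc k) < p k" for k
    using td(4)[of k] d_le_p order_less_le_trans by blast
  then have p0: "0 < p k" for k
    by (rule less_trans[rotated]) simp
  define X where "X k i = inverse (p k) * d k i" for k i
  have Xb: "\<bar>X k i\<bar> \<le> 1" if "i < n" for k i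
    using d_le_p[OF that, of k] dpos[OF that, of k] p0[of k] by (simp add: X_def abs_mult field_simps)
  have Xsum: "(\<Sum>i<n. X k i) = 1" for k
    using p0[of k] by (simp add: X_def p_def flip: sum_distrib_left)
  \<comment> \<open>After normalisation the constant 1 becomes p^-(m-1), which vanishes as the
    solutions blow up; what survives in the limit is the eigenvalue equation.\<close>
  have Xeq: "t k * X k i ^ (m - 1) = inverse (p k) ^ (m - 1) + tapply m n B (X k) i" if "i < n" for k i
  proof -
    have "t k * X k i ^ (m - 1) = inverse (p k) ^ (m - 1) * (t k * d k i ^ (m - 1))"
      by (simp add: X_def power_mult_distrib)
    also have "t k * d k i ^ (m - 1) = 1 + tapply m n B (d k) i"
      using td(3) that by (auto simp: sol_def)
    finally show ?thesis unfolding X_def tapply_scale by (simp add: algebra_simps)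
  qed
  obtain r x where r: "strict_mono r" and x: "\<And>i. i < n \<Longrightarrow> (\<lambda>k. X (r k) i) \<longlonglongrightarrow> x i"
    using pointwise_convergent_subsequence[of n X 1] Xb by blast
  have lim0: "(\<lambda>k. 1 / real (Suc k)) \<longlonglongrightarrow> 0"
    using LIMSEQ_inverse_real_of_nat by (simp add: inverse_eq_divide)
  have "t \<longlonglongrightarrow> s"
  proof (rule tendsto_sandwich[OF always_eventually[OF allI] always_eventually[OF allI] tendsto_const])
    show "(\<lambda>k. s + 1 / real (Suc k)) \<longlonglongrightarrow> s"
      using tendsto_add[OF tendsto_const lim0, of s] by simp
    show "s \<le> t k" "t k \<le> s + 1 / real (Suc k)" for k
      using td(1,2)[of k] by simp_all
  qed
  then have tr: "(\<lambda>k. t (r k)) \<longlonglongrightarrow> s"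
    using LIMSEQ_subseq_LIMSEQ[OF _ r] by (simp add: o_def)
  have "(\<lambda>k. inverse (p k)) \<longlonglongrightarrow> 0"
  proof (rule tendsto_sandwich[OF _ _ tendsto_const lim0])
    show "\<forall>\<^sub>F k in sequentially. 0 \<le> inverse (p k)"
      using p0 by (auto intro!: always_eventually less_imp_le)
    have "inverse (p k) \<le> 1 / real (Suc k)" for k
      using le_imp_inverse_le[OF less_imp_le[OF p[of k]]] by (simp add: inverse_eq_divide)
    then show "\<forall>\<^sub>F k in sequentially. inverse (p k) \<le> 1 / real (Suc k)"
      by (rule always_eventually[OF allI])
  qed
  then have "(\<lambda>k. inverse (p k) ^ (m - 1)) \<longlonglongrightarrow> 0"
    using tendsto_power[of "\<lambda>k. inverse (p k)" 0 sequentially "m - 1"] m1 by (simp add: zero_power)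
  then have pr: "(\<lambda>k. inverse (p (r k)) ^ (m - 1)) \<longlonglongrightarrow> 0"
    using LIMSEQ_subseq_LIMSEQ[OF _ r] by (simp add: o_def)
  have eig: "tapply m n B x i = s * x i ^ (m - 1)" if i: "i < n" for i
  proof (rule LIMSEQ_unique)
    show "(\<lambda>k. t (r k) * X (r k) i ^ (m - 1)) \<longlonglongrightarrow> s * x i ^ (m - 1)"
      by (intro tendsto_mult tendsto_power tr x i)
    show "(\<lambda>k. t (r k) * X (r k) i ^ (m - 1)) \<longlonglongrightarrow> tapply m n B x i"
      unfolding Xeq[OF i] using tendsto_add[OF pr tendsto_tapply[of n "\<lambda>k. X (r k)" x m B i]] x by simp
  qed
  have "(\<lambda>k. \<Sum>i<n. X (r k) i) \<longlonglongrightarrow> (\<Sum>i<n. x i)"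
    using x by (intro tendsto_sum) auto
  then have "(\<Sum>i<n. x i) = 1"
    by (simp add: Xsum LIMSEQ_const_iff)
  then have "\<exists>i<n. x i \<noteq> 0"
    by (metis lessThan_iff sum.neutral zero_neq_one)
  moreover have "tapply m n B (\<lambda>i. complex_of_real (x i)) i = of_real s * of_real (x i) ^ (m - 1)"
    if "i < n" for i
  proof -
    have "prod_list (map (\<lambda>i. complex_of_real (x i)) js) = of_real (prod_list (map x js))" for js
      by (induction js) simp_all
    then have "tapply m n B (\<lambda>i. complex_of_real (x i)) i = of_real (tapply m n B x i)"
      by (simp add: tapply_def)
    then show ?thesis by (simp add: eig[OF that])
  qed
  ultimately have "is_eigenvalue m n B (of_real s)"
    unfolding is_eigenvalue_def by (intro exI[of _ "\<lambda>i. complex_of_real (x i)"]) auto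
  moreover have "\<exists>d. (\<forall>i<n. 0 < d i) \<and> (\<forall>i<n. tapply m n B d i \<le> t' * d i ^ (m - 1))"
    if st': "s < t'" for t'
  proof -
    obtain t where t: "t \<in> T" "t < t'" using above[OF st'] by blast
    then obtain d where d: "sol t d" by (auto simp: T_def)
    have "tapply m n B d i \<le> t' * d i ^ (m - 1)" if "i < n" for i
    proof -
      have "tapply m n B d i \<le> t * d i ^ (m - 1)" "0 < d i" using d that by (auto simp: sol_def)
      moreover have "t * d i ^ (m - 1) \<le> t' * d i ^ (m - 1)"
        using t \<open>0 < d i\<close> by (intro mult_right_mono) auto
      ultimately show ?thesis by linarith
    qed
    then show ?thesis using d by (auto simp: sol_def)
  qed
  ultimately show ?thesis using that s0 by blast
qed

text \<open>A \<open>Sup\<close> bounds its members only if the set is bounded above. The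
  maximal-ratio argument with \<open>d\<close> = 1 bounds every eigenvalue by a row sum of
  \<open>B\<close>.\<close>

lemma eigenvalue_norm_le_spectral_radius:
  assumes B: "nonneg_tensor m n B" and m: "m \<ge> 1" and lam: "is_eigenvalue m n B lam"
  shows "cmod lam \<le> tensor_spectral_radius m n B"
proof -
  have "cmod mu \<le> (\<Sum>i<n. tapply m n B (\<lambda>_. 1::real) i)" if mu: "is_eigenvalue m n B mu" for mu
  proof -
    obtain x j where x: "j < n" "x j \<noteq> (0::complex)"
      and eig: "\<And>i. i < n \<Longrightarrow> tapply m n B x i = mu * x i ^ (m - 1)"
      using mu by (auto simp: is_eigenvalue_def)
    obtain i where i: "i < n" "x i \<noteq> 0"
      and "norm (tapply m n B x i) \<le> tapply m n B (\<lambda>_. 1::real) i * norm (x i) ^ (m - 1)"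
      using tapply_le_of_max_ratio[OF B m, where d = "\<lambda>_. 1" and x = x and j = j
          and c = "\<lambda>i. tapply m n B (\<lambda>_. 1::real) i"] x by auto
    then have "cmod mu \<le> tapply m n B (\<lambda>_. 1::real) i"
      by (simp add: eig norm_mult norm_power mult_le_cancel_right)
    also have "\<dots> \<le> (\<Sum>i<n. tapply m n B (\<lambda>_. 1::real) i)"
      using i tapply_nonneg[OF B m, of _ "\<lambda>_. 1"] by (intro member_le_sum) auto
    finally show ?thesis .
  qed
  then have "bdd_above (cmod ` {lam. is_eigenvalue m n B lam})"
    by (intro bdd_aboveI[of _ "\<Sum>i<n. tapply m n B (\<lambda>_. 1::real) i"]) auto
  then show ?thesis
    unfolding tensor_spectral_radius_def using lam by (intro cSup_upper) auto
qed

lemma dominating_vector_above_spectral_radius: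
  assumes B: "nonneg_tensor m n B" and m: "m \<ge> 2" and s: "tensor_spectral_radius m n B < s"
  obtains d :: "nat \<Rightarrow> real" where "\<And>i. i < n \<Longrightarrow> 0 < d i"
    "\<And>i. i < n \<Longrightarrow> tapply m n B d i \<le> s * d i ^ (m - 1)"
proof (cases "n = 0")
  case False
  then obtain t where t: "0 \<le> t" "is_eigenvalue m n B (of_real t)"
    and d: "\<And>t'. t < t' \<Longrightarrow> \<exists>d. (\<forall>i<n. 0 < d i) \<and> (\<forall>i<n. tapply m n B d i \<le> t' * d i ^ (m - 1))"
    using dominating_vectors_above_eigenvalue[OF B m] by blast
  have "t \<le> tensor_spectral_radius m n B"
    using eigenvalue_norm_le_spectral_radius[OF B _ t(2)] m t(1) by simp
  then obtain d where "\<forall>i<n. 0 < d i" "\<forall>i<n. tapply m n B d i \<le> s * d i ^ (m - 1)"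
    using d[of s] s by force
  then show ?thesis using that by blast
next
  case True
  then show ?thesis using that by blast
qed

text \<open>Since \<open>A\<close> is nonnegative, \<open>B\<close> agrees with \<open>A\<close> off
  the diagonal and equals s - a_ii on it. The inequality B d^(m-1) \<le> (s + e) d^[m-1] is thus,
  row by row, scaled dominance of \<open>A\<close> with excess \<open>e\<close>.\<close>

lemma H_tensor_H_eigenvalue_nonneg:
  assumes A: "nonneg_tensor m n A" and m: "m \<ge> 2"
    and H: "is_H_tensor m n A" and lam: "is_H_eigenvalue m n A lam"
  shows "0 \<le> lam"
proof (rule field_le_epsilon)
  fix e :: real assume e: "0 < e"
  have m1: "m \<ge> 1" using m by simp
  obtain s B where B: "nonneg_tensor m n B" and s: "tensor_spectral_radius m n B \<le> s"
    and eq: "\<And>xs. xs \<in> idx m n \<Longrightarrow> comparison_tensor A xs = s * unit_tensor xs - B xs"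
    using H by (auto simp: is_H_tensor_def is_M_tensor_def)
  have *: "tensor_spectral_radius m n B < s + e" using s e by simp
  obtain d :: "nat \<Rightarrow> real" where d: "\<And>i. i < n \<Longrightarrow> 0 < d i"
    and Bd: "\<And>i. i < n \<Longrightarrow> tapply m n B d i \<le> (s + e) * d i ^ (m - 1)"
    using dominating_vector_above_spectral_radius[OF B m *] by blast
  have idx: "i # js \<in> idx m n" if "i < n" "js \<in> idx (m - 1) n" for i js
    using Cons_in_idx_iff[of i js "m - 1" n] that m by simp
  have "(\<Sum>js\<in>idx (m - 1) n - {replicate (m - 1) i}. A (i # js) * prod_list (map d js))
        \<le> (A (replicate m i) + e) * d i ^ (m - 1)" if i: "i < n" for i
  proof -
    have diag: "B (i # replicate (m - 1) i) = s - A (i # replicate (m - 1) i)"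
      using eq[OF idx[OF i replicate_in_idx[OF i]]] nonneg_tensor_Cons[OF A m1 i replicate_in_idx[OF i]]
      by (simp add: comparison_tensor_def unit_tensor_def is_diag_index_Cons)
    have off: "B (i # js) = A (i # js)" if "js \<in> idx (m - 1) n - {replicate (m - 1) i}" for js
      using that eq[OF idx[OF i, of js]] nonneg_tensor_Cons[OF A m1 i, of js]
      by (auto simp: comparison_tensor_def unit_tensor_def is_diag_index_Cons length_idx)
    have "(\<Sum>js\<in>idx (m - 1) n - {replicate (m - 1) i}. A (i # js) * prod_list (map d js))
        = (\<Sum>js\<in>idx (m - 1) n - {replicate (m - 1) i}. B (i # js) * prod_list (map d js))"
      using off by (intro sum.cong) simp_all
    also have "\<dots> = tapply m n B d i - (s - A (i # replicate (m - 1) i)) * d i ^ (m - 1)"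
      using tapply_split_diag[OF i, of m B d] diag by simp
    also have "\<dots> \<le> (A (replicate m i) + e) * d i ^ (m - 1)"
      unfolding replicate_eq_Cons_pred[OF m1] using Bd[OF i] by (simp add: algebra_simps)
    finally show ?thesis .
  qed
  from H_eigenvalue_ge_of_scaled_dominance[OF A m1 d this lam] show "0 \<le> lam + e" by simp
qed

section \<open>MB0-tensors\<close>

lemma prod_power_le_mean_power:
  fixes z :: "nat \<Rightarrow> real"
  assumes z: "\<And>k. k < m \<Longrightarrow> 0 \<le> z k" and m: "m > 0"
  shows "real m * (\<Prod>k<m. z k) \<le> (\<Sum>k<m. z k ^ m)"
proof -
  have "(\<Prod>k<m. z k ^ m) powr (1 / real m) \<le> (\<Sum>k<m. z k ^ m / real m)"
    using arith_geom_mean[of "{..<m}" "\<lambda>k. z k ^ m"] z m by (auto simp: lessThan_empty_iff)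
  moreover have "(\<Prod>k<m. z k ^ m) powr (1 / real m) = (\<Prod>k<m. z k)"
  proof -
    have "0 \<le> (\<Prod>k<m. z k)" using z by (intro prod_nonneg) auto
    moreover have "(p ^ m) powr (1 / real m) = p" if "0 \<le> p" for p
      using that m by (cases "p = 0") (simp_all add: powr_powr flip: powr_realpow)
    ultimately show ?thesis by (simp only: prod_power_distrib[symmetric])
  qed
  ultimately show ?thesis
    using m by (simp add: sum_divide_distrib[symmetric] field_simps)
qed

text \<open>Swapping the entries at positions 0 and \<open>k\<close> is an involution of the index
  lists that preserves \<open>C\<close> and the product, so the weight may be moved to the first
  position; summing over the tail then produces C d^(m-1).\<close>

lemma sum_idx_position:
  fixes d g :: "nat \<Rightarrow> real"
  assumes sym: "is_symmetric m n C" and k: "k < m"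
  shows "(\<Sum>xs\<in>idx m n. C xs * prod_list (map d xs) * g (xs ! k))
       = (\<Sum>i<n. g i * d i * tapply m n C d i)"
proof -
  define \<tau> where "\<tau> xs = xs[k := xs ! 0, 0 := xs ! k]" for xs :: "nat list"
  have ms: "mset (\<tau> xs) = mset xs" if "xs \<in> idx m n" for xs
    unfolding \<tau>_def using that k by (intro mset_swap) (auto simp: length_idx)
  have \<tau>_idx: "\<tau> xs \<in> idx m n" if "xs \<in> idx m n" for xs
    using that ms[OF that] mset_eq_setD[OF ms[OF that]] mset_eq_length[OF ms[OF that]]
    by (simp add: idx_def)
  have \<tau>_inv: "\<tau> (\<tau> xs) = xs" if "xs \<in> idx m n" for xs
    using that k by (intro nth_equalityI) (auto simp: \<tau>_def nth_list_update length_idx)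
  have C: "C (\<tau> xs) = C xs" if "xs \<in> idx m n" for xs
    using sym that ms[OF that] unfolding is_symmetric_def by blast
  have pr: "prod_list (map d (\<tau> xs)) = prod_list (map d xs)" if "xs \<in> idx m n" for xs
    using arg_cong[OF ms[OF that], of "\<lambda>M. prod_mset (image_mset d M)"]
    by (simp add: prod_mset_prod_list flip: mset_map)
  have "(\<Sum>xs\<in>idx m n. C xs * prod_list (map d xs) * g (xs ! k))
      = (\<Sum>xs\<in>idx m n. C xs * prod_list (map d xs) * g (xs ! 0))"
    by (rule sum.reindex_bij_witness[of _ \<tau> \<tau>])
       (use k in \<open>auto simp: \<tau>_idx \<tau>_inv C pr\<close>, auto simp: \<tau>_def length_idx nth_list_update)
  also have "\<dots> = (\<Sum>i<n. \<Sum>js\<in>idx (m - 1) n. C (i # js) * (d i * prod_list (map d js)) * g i)"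
    using sum_idx_Suc[of "\<lambda>xs. C xs * prod_list (map d xs) * g (xs ! 0)" "m - 1" n] k by simp
  also have "\<dots> = (\<Sum>i<n. g i * d i * tapply m n C d i)"
    by (simp add: tapply_real sum_distrib_left ac_simps)
  finally show ?thesis .
qed

text \<open>Schur test: apply AM-GM to the ratios \<open>y i / d i\<close>; by symmetry each of the \<open>m\<close> positions
  contributes the same sum.\<close>
lemma form_le_of_dominating_vector:
  assumes C: "nonneg_tensor m n C" and sym: "is_symmetric m n C" and m: "m > 0"
    and d: "\<And>i. i < n \<Longrightarrow> 0 < d i"
    and Cd: "\<And>i. i < n \<Longrightarrow> tapply m n C d i \<le> c * d i ^ (m - 1)"
    and y: "\<And>i. i < n \<Longrightarrow> 0 \<le> y i"
  shows "(\<Sum>xs\<in>idx m n. C xs * prod_list (map y xs)) \<le> c * (\<Sum>i<n. y i ^ m)"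
proof -
  define z where "z i = y i / d i" for i
  have z0: "0 \<le> z i" if "i < n" for i using d[OF that] y[OF that] by (simp add: z_def)
  have summand: "real m * (C xs * prod_list (map y xs)) \<le> (\<Sum>k<m. C xs * prod_list (map d xs) * z (xs ! k) ^ m)"
    if xs: "xs \<in> idx m n" for xs
  proof -
    have lt: "xs ! k < n" if "k < m" for k
      using length_idx[OF xs] that by (intro lessThan_iff[THEN iffD1] subsetD[OF set_idx[OF xs]] nth_mem) simp
    have "prod_list (map y xs) = prod_list (map (\<lambda>i. d i * z i) xs)"
      using set_idx[OF xs] d by (intro arg_cong[of _ _ prod_list] map_cong) (force simp: z_def)+
    also have "\<dots> = prod_list (map d xs) * (\<Prod>k<m. z (xs ! k))"
      using length_idx[OF xs] by (simp add: prod_list_map_mult prod.list_conv_set_nth lessThan_atLeast0 prod.distrib)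
    finally have eq: "prod_list (map y xs) = prod_list (map d xs) * (\<Prod>k<m. z (xs ! k))" .
    have "0 \<le> C xs * prod_list (map d xs)"
      using C xs set_idx[OF xs] d
      by (intro mult_nonneg_nonneg prod_list_map_nonneg) (auto simp: nonneg_tensor_def intro: less_imp_le)
    then have "C xs * prod_list (map d xs) * (real m * (\<Prod>k<m. z (xs ! k)))
        \<le> C xs * prod_list (map d xs) * (\<Sum>k<m. z (xs ! k) ^ m)"
      using lt z0 m by (intro mult_left_mono prod_power_le_mean_power) auto
    then show ?thesis by (simp add: eq sum_distrib_left ac_simps)
  qed
  have "real m * (\<Sum>xs\<in>idx m n. C xs * prod_list (map y xs))
      \<le> (\<Sum>xs\<in>idx m n. \<Sum>k<m. C xs * prod_list (map d xs) * z (xs ! k) ^ m)"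
    unfolding sum_distrib_left by (intro sum_mono summand)
  also have "\<dots> = (\<Sum>k<m. \<Sum>xs\<in>idx m n. C xs * prod_list (map d xs) * z (xs ! k) ^ m)"
    by (rule sum.swap)
  also have "\<dots> = (\<Sum>k<m. \<Sum>i<n. z i ^ m * d i * tapply m n C d i)"
    using sum_idx_position[OF sym, where g = "\<lambda>i. z i ^ m"] by simp
  also have "\<dots> = real m * (\<Sum>i<n. z i ^ m * d i * tapply m n C d i)"
    by simp
  also have "\<dots> \<le> real m * (\<Sum>i<n. c * y i ^ m)"
  proof (intro mult_left_mono sum_mono)
    fix i assume "i \<in> {..<n}"
    then have i: "i < n" by simp
    have "z i ^ m * d i * tapply m n C d i \<le> z i ^ m * d i * (c * d i ^ (m - 1))"
      using d[OF i] z0[OF i] by (intro mult_left_mono Cd[OF i]) auto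
    also have "\<dots> = c * (z i ^ m * d i ^ m)"
      using m by (cases m) (simp_all add: ac_simps)
    also have "\<dots> = c * y i ^ m"
      using d[OF i] by (simp add: z_def flip: power_mult_distrib)
    finally show "z i ^ m * d i * tapply m n C d i \<le> c * y i ^ m" .
  qed simp
  finally show ?thesis using m by (simp flip: sum_distrib_left)
qed

text \<open>Peeling off the smallest positive value \<open>h\<close> of \<open>b\<close>, attained on \<open>S = {i. b i > 0}\<close>, splits
  off the form \<open>h * (\<Sum>i\<in>S. x i) ^ m\<close>.\<close>
lemma min_form_nonneg:
  fixes b x :: "nat \<Rightarrow> real"
  assumes m: "even m" "m > 0" and b: "\<And>i. i < n \<Longrightarrow> 0 \<le> b i"
  shows "0 \<le> (\<Sum>xs\<in>idx m n. Min (b ` set xs) * prod_list (map x xs))"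
  using b
proof (induction "card {i. i < n \<and> 0 < b i}" arbitrary: b rule: less_induct)
  case less
  define S where "S = {i. i < n \<and> 0 < b i}"
  have fS: "finite S" by (simp add: S_def)
  have ne: "set xs \<noteq> {}" "finite (b ` set xs)" if "xs \<in> idx m n" for xs
    using length_idx[OF that] m by auto
  show ?case
  proof (cases "S = {}")
    case True
    have "Min (b ` set xs) = 0" if "xs \<in> idx m n" for xs
    proof -
      have "b i = 0" if "i \<in> set xs" for i
        using True less.prems[of i] set_idx[OF \<open>xs \<in> idx m n\<close>] that by (force simp: S_def)
      then have "b ` set xs = (\<lambda>_. 0) ` set xs" by (intro image_cong refl)
      also have "\<dots> = {0}" using ne(1)[OF that] by (simp add: image_constant_conv)
      finally show ?thesis by simp
    qed
    then show ?thesis by simp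
  next
    case False
    define h where "h = Min (b ` S)"
    have hmem: "h \<in> b ` S" unfolding h_def using fS False by (intro Min_in) auto
    have hle: "h \<le> b i" if "i \<in> S" for i unfolding h_def using fS that by (intro Min_le) auto
    have h0: "0 < h" using hmem by (auto simp: S_def)
    define b' where "b' i = (if i \<in> S then b i - h else b i)" for i
    have b'0: "0 \<le> b' i" if "i < n" for i
      using less.prems[OF that] hle by (auto simp: b'_def)
    \<comment> \<open>A minimiser of \<open>b\<close> on \<open>S\<close> drops to 0, so the
      induction measure strictly decreases.\<close>
    have "{i. i < n \<and> 0 < b' i} \<subset> S"
    proof -
      obtain i where "i \<in> S" "b i = h" using hmem by auto
      then have "i \<notin> {i. i < n \<and> 0 < b' i}" by (simp add: b'_def)
      moreover have "{i. i < n \<and> 0 < b' i} \<subseteq> S" by (auto simp: b'_def S_def split: if_splits)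
      ultimately show ?thesis using \<open>i \<in> S\<close> by blast
    qed
    then have IH: "0 \<le> (\<Sum>xs\<in>idx m n. Min (b' ` set xs) * prod_list (map x xs))"
      using fS b'0 unfolding S_def by (intro less.hyps psubset_card_mono) auto
    \<comment> \<open>If all indices lie in \<open>S\<close>, every value and hence the minimum
      drops by exactly \<open>h\<close>. Otherwise some index has \<open>b\<close> =
      \<open>b'\<close> = 0, both minima vanish, and the truncated product is 0.\<close>
    have split: "Min (b ` set xs) * prod_list (map x xs)
        = Min (b' ` set xs) * prod_list (map x xs) + h * prod_list (map (\<lambda>i. if i \<in> S then x i else 0) xs)"
      if xs: "xs \<in> idx m n" for xs
    proof (cases "set xs \<subseteq> S")
      case True
      have "Min (b ` set xs) = Min (b' ` set xs) + h"
      proof -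
        have "b ` set xs = (\<lambda>t. t + h) ` b' ` set xs"
          using True by (force simp: b'_def image_image)
        then show ?thesis
          using ne[OF xs] mono_Min_commute[of "\<lambda>t. t + h" "b' ` set xs"] by (simp add: mono_def)
      qed
      moreover have "prod_list (map (\<lambda>i. if i \<in> S then x i else 0) xs) = prod_list (map x xs)"
        using True by (intro arg_cong[of _ _ prod_list] map_cong) auto
      ultimately show ?thesis by (simp add: algebra_simps)
    next
      case False
      then obtain i where i: "i \<in> set xs" "i \<notin> S" by auto
      then have bi: "b i = 0" "b' i = 0"
        using set_idx[OF xs] less.prems[of i] by (force simp: S_def b'_def)+
      have "Min (b ` set xs) = 0"
        using i bi less.prems set_idx[OF xs] by (intro Min_eqI) force+
      moreover have "Min (b' ` set xs) = 0"
        using i bi b'0 set_idx[OF xs] by (intro Min_eqI) force+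
      moreover have "prod_list (map (\<lambda>i. if i \<in> S then x i else 0) xs) = 0"
        using i by (simp add: prod_list_zero_iff image_iff) force
      ultimately show ?thesis by simp
    qed
    have "(\<Sum>xs\<in>idx m n. Min (b ` set xs) * prod_list (map x xs))
        = (\<Sum>xs\<in>idx m n. Min (b' ` set xs) * prod_list (map x xs))
          + h * (\<Sum>i<n. if i \<in> S then x i else 0) ^ m"
      by (simp add: split sum.distrib flip: sum_prod_list_idx sum_distrib_left)
    also have "\<dots> \<ge> 0"
      using IH h0 m by (intro add_nonneg_nonneg mult_nonneg_nonneg zero_le_even_power) auto
    finally show ?thesis .
  qed
qed

section \<open>Forms at eigenvectors, diagonal indices and the bounds beta\<close>

lemma sum_form_eq_tapply:
  fixes x :: "nat \<Rightarrow> real"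
  assumes "m \<ge> 1"
  shows "(\<Sum>xs\<in>idx m n. A xs * prod_list (map x xs)) = (\<Sum>i<n. x i * tapply m n A x i)"
  using assms sum_idx_Suc[of "\<lambda>xs. A xs * prod_list (map x xs)" "m - 1" n]
  by (simp add: tapply_real sum_distrib_left ac_simps)

lemma tapply_unit_tensor:
  assumes "i < n"
  shows "tapply m n unit_tensor (x :: nat \<Rightarrow> real) i = x i ^ (m - 1)"
proof -
  have "unit_tensor (i # js) = 0" if "js \<in> idx (m - 1) n - {replicate (m - 1) i}" for js
    using that by (auto simp: unit_tensor_def is_diag_index_Cons length_idx)
  then show ?thesis
    by (simp add: tapply_split_diag[OF assms]) (simp add: unit_tensor_def is_diag_index_Cons)
qed

lemma form_eq_of_eigenvector:
  fixes x :: "nat \<Rightarrow> real"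
  assumes "m \<ge> 1" "\<And>i. i < n \<Longrightarrow> tapply m n A x i = lam * x i ^ (m - 1)"
  shows "(\<Sum>xs\<in>idx m n. A xs * prod_list (map x xs)) = lam * (\<Sum>i<n. x i ^ m)"
proof -
  have "(\<Sum>i<n. x i * tapply m n A x i) = (\<Sum>i<n. lam * x i ^ m)"
    using assms by (intro sum.cong) (auto simp: power_eq_if[of _ m])
  then show ?thesis by (simp add: sum_form_eq_tapply[OF assms(1)] sum_distrib_left)
qed

lemma sum_even_power_pos:
  fixes x :: "nat \<Rightarrow> real"
  assumes "even m" "j < n" "x j \<noteq> 0"
  shows "0 < (\<Sum>i<n. x i ^ m)"
proof (rule sum_pos2)
  show "0 < x j ^ m" using assms by (simp add: zero_less_power_eq)
  show "0 \<le> x i ^ m" for i using assms(1) by (rule zero_le_even_power)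
qed (use assms(2) in auto)

lemma is_diag_index_iff: "is_diag_index xs \<longleftrightarrow> (\<forall>i\<in>set xs. \<forall>j\<in>set xs. i = j)"
proof
  assume "is_diag_index xs"
  then have "xs = replicate (length xs) (hd xs)" by (simp add: is_diag_index_def)
  then have "i = hd xs" if "i \<in> set xs" for i
    using that by (metis in_set_replicate)
  then show "\<forall>i\<in>set xs. \<forall>j\<in>set xs. i = j" by blast
next
  assume *: "\<forall>i\<in>set xs. \<forall>j\<in>set xs. i = j"
  have "replicate (length xs) (hd xs) = xs"
  proof (rule replicate_length_same, rule ballI)
    fix i assume i: "i \<in> set xs"
    then have "hd xs \<in> set xs" by (intro hd_in_set) auto
    with * i show "i = hd xs" by blast
  qed
  then show "is_diag_index xs" by (simp add: is_diag_index_def)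
qed

lemma is_diag_index_mset_cong: "mset ys = mset xs \<Longrightarrow> is_diag_index ys \<longleftrightarrow> is_diag_index xs"
  unfolding is_diag_index_iff by (drule mset_eq_setD) simp

lemma beta_MB_nonneg: "0 \<le> beta_MB m n A i"
  by (simp add: beta_MB_def)

lemma le_beta_MB:
  assumes "js \<in> idx (m - 1) n" "js \<noteq> replicate (m - 1) i"
  shows "A (i # js) \<le> beta_MB m n A i"
  unfolding beta_MB_def using assms by (intro Max_ge) auto

text \<open>\<open>beta_MB\<close> looks at the first index only; symmetry moves any index of
  \<open>xs\<close> to the front. Off-diagonal entries are thus bounded by the minimum of beta over
  all their indices.\<close>

lemma le_beta_MB_of_mem:
  assumes sym: "is_symmetric m n A" and xs: "xs \<in> idx m n" and nd: "\<not> is_diag_index xs"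
    and i: "i \<in> set xs"
  shows "A xs \<le> beta_MB m n A i"
proof -
  have ms: "mset (i # remove1 i xs) = mset xs" using i by simp
  have len: "length (remove1 i xs) = m - 1" using i xs by (simp add: length_remove1 length_idx)
  have js: "remove1 i xs \<in> idx (m - 1) n"
    using len xs set_remove1_subset[of i xs] by (auto simp: idx_def)
  have "remove1 i xs \<noteq> replicate (m - 1) i"
    using is_diag_index_mset_cong[OF ms] nd len by (simp add: is_diag_index_Cons)
  then have "A (i # remove1 i xs) \<le> beta_MB m n A i" by (rule le_beta_MB[OF js])
  moreover have "A (i # remove1 i xs) = A xs"
    using sym xs ms unfolding is_symmetric_def by blast
  ultimately show ?thesis by simp
qed

text \<open>Row i of A x^(m-1) is s x_i^(m-1) - (B x^(m-1))_i + b_i (sum of x)^(m-1). The last term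
  is nonnegative because m - 1 is even, and at a component of maximal ratio the middle one is
  controlled by (s + e) x_i^(m-1).\<close>

lemma MB0_odd_H_eigenvalue_ge:
  assumes m: "odd m" "m \<ge> 2" and B: "nonneg_tensor m n B"
    and eq: "\<And>xs. xs \<in> idx m n \<Longrightarrow> A xs = s * unit_tensor xs - B xs + b (hd xs)"
    and b: "\<And>i. i < n \<Longrightarrow> 0 \<le> b i"
    and d: "\<And>i. i < n \<Longrightarrow> 0 < d i" "\<And>i. i < n \<Longrightarrow> tapply m n B d i \<le> (s + e) * d i ^ (m - 1)"
    and lam: "is_H_eigenvalue m n A lam"
  shows "- e \<le> lam"
proof -
  have m1: "m \<ge> 1" and ev: "even (m - 1)" using m by auto
  obtain x j where x: "j < n" "x j \<noteq> (0::real)"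
    and eig: "\<And>i. i < n \<Longrightarrow> tapply m n A x i = lam * x i ^ (m - 1)"
    using lam by (auto simp: is_H_eigenvalue_def)
  obtain i where i: "i < n" "x i \<noteq> 0" and "norm (tapply m n B x i) \<le> (s + e) * norm (x i) ^ (m - 1)"
    using tapply_le_of_max_ratio[where B = B and d = d and x = x and j = j and m = m and n = n
        and c = "\<lambda>_. s + e", OF B m1] d x
    by blast
  then have le: "tapply m n B x i \<le> (s + e) * x i ^ (m - 1)"
    using ev by (simp add: power_even_abs)
  have "i # js \<in> idx m n" if "js \<in> idx (m - 1) n" for js
    using Cons_in_idx_iff[of i js "m - 1" n] that i m1 by simp
  then have "tapply m n A x i
      = s * tapply m n unit_tensor x i - tapply m n B x i + b i * (\<Sum>js\<in>idx (m - 1) n. prod_list (map x js))"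
    by (simp add: tapply_real eq algebra_simps sum.distrib sum_subtractf sum_distrib_left)
  also have "\<dots> = s * x i ^ (m - 1) - tapply m n B x i + b i * (\<Sum>i<n. x i) ^ (m - 1)"
    by (simp add: tapply_unit_tensor[OF i(1)] sum_prod_list_idx)
  also have "\<dots> \<ge> s * x i ^ (m - 1) - (s + e) * x i ^ (m - 1)"
    using le mult_nonneg_nonneg[OF b[OF i(1)] zero_le_even_power[OF ev, of "\<Sum>i<n. x i"]] by linarith
  finally have "0 \<le> (lam + e) * x i ^ (m - 1)"
    using eig[OF i(1)] by (simp add: algebra_simps)
  moreover have "0 < x i ^ (m - 1)" using ev i(2) by (simp add: zero_less_power_eq)
  ultimately show ?thesis by (simp add: zero_le_mult_iff)
qed

text \<open>The minimum of beta over all indices replaces beta of the first one, giving the symmetry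
  that the Schur test needs. This only decreases entries, so \<open>C\<close> \<le> \<open>B\<close>
  and \<open>d\<close> still dominates \<open>C\<close>; the form of the minima is nonnegative and
  can be discarded.\<close>

lemma MB0_even_H_eigenvalue_ge:
  assumes m: "even m" "m \<ge> 2" and sym: "is_symmetric m n A" and B: "nonneg_tensor m n B"
    and eq: "\<And>xs. xs \<in> idx m n \<Longrightarrow> A xs = s * unit_tensor xs - B xs + beta_MB m n A (hd xs)"
    and d: "\<And>i. i < n \<Longrightarrow> 0 < d i" "\<And>i. i < n \<Longrightarrow> tapply m n B d i \<le> (s + e) * d i ^ (m - 1)"
    and lam: "is_H_eigenvalue m n A lam"
  shows "- e \<le> lam"
proof -
  have m1: "m \<ge> 1" "m > 0" using m by auto
  define b where "b = beta_MB m n A"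
  define C where "C xs = s * unit_tensor xs - A xs + Min (b ` set xs)" for xs
  have ne: "xs \<noteq> []" if "xs \<in> idx m n" for xs using length_idx[OF that] m1 by auto
  have "C ys = C xs" if "xs \<in> idx m n" "mset ys = mset xs" for xs ys
  proof -
    have "A ys = A xs" using sym that unfolding is_symmetric_def by blast
    then show ?thesis
      using is_diag_index_mset_cong[OF that(2)] mset_eq_setD[OF that(2)]
      by (simp add: C_def unit_tensor_def)
  qed
  then have Csym: "is_symmetric m n C" unfolding is_symmetric_def by blast
  have CB: "C xs \<le> B xs" if "xs \<in> idx m n" for xs
  proof -
    have "Min (b ` set xs) \<le> b (hd xs)" using ne[OF that] by (intro Min_le) auto
    then show ?thesis using eq[OF that] by (simp add: C_def b_def)
  qed
  \<comment> \<open>On the diagonal the minimum is the single beta value and \<open>C\<close> =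
    \<open>B\<close>; off the diagonal the claim says that \<open>A\<close> is bounded by beta at
    each of its indices.\<close>
  have C0: "0 \<le> C xs" if xs: "xs \<in> idx m n" for xs
  proof (cases "is_diag_index xs")
    case True
    then have "set xs = {hd xs}" using ne[OF xs]
      by (metis is_diag_index_def length_0_conv set_replicate)
    then have "C xs = B xs" using eq[OF xs] True by (simp add: C_def b_def unit_tensor_def)
    then show ?thesis using B xs by (simp add: nonneg_tensor_def)
  next
    case False
    have "A xs \<le> Min (b ` set xs)"
      using ne[OF xs] le_beta_MB_of_mem[OF sym xs False] by (intro Min.boundedI) (auto simp: b_def)
    then show ?thesis using False by (simp add: C_def unit_tensor_def)
  qed
  have Cd: "tapply m n C d i \<le> (s + e) * d i ^ (m - 1)" if i: "i < n" for i
  proof -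
    have "tapply m n C d i \<le> tapply m n B d i"
      unfolding tapply_real
    proof (intro sum_mono mult_right_mono)
      fix js assume js: "js \<in> idx (m - 1) n"
      show "C (i # js) \<le> B (i # js)"
        using CB Cons_in_idx_iff[of i js "m - 1" n] js i m1 by simp
      show "0 \<le> prod_list (map d js)"
        using set_idx[OF js] d(1) by (intro prod_list_map_nonneg) (auto intro: less_imp_le)
    qed
    then show ?thesis using d(2)[OF i] by simp
  qed
  obtain x j where x: "j < n" "x j \<noteq> (0::real)"
    and eig: "\<And>i. i < n \<Longrightarrow> tapply m n A x i = lam * x i ^ (m - 1)"
    using lam by (auto simp: is_H_eigenvalue_def)
  define X where "X = (\<Sum>i<n. x i ^ m)"
  have X: "0 < X" unfolding X_def using m(1) x by (rule sum_even_power_pos)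
  have prod_le_abs: "prod_list (map x xs) \<le> prod_list (map (\<lambda>i. \<bar>x i\<bar>) xs)" for xs
    using norm_prod_list_map[of x xs] by simp
  have "(\<Sum>xs\<in>idx m n. C xs * prod_list (map x xs)) \<le> (\<Sum>xs\<in>idx m n. C xs * prod_list (map (\<lambda>i. \<bar>x i\<bar>) xs))"
    using C0 prod_le_abs by (intro sum_mono mult_left_mono)
  also have "\<dots> \<le> (s + e) * (\<Sum>i<n. \<bar>x i\<bar> ^ m)"
    using C0 by (intro form_le_of_dominating_vector[OF _ Csym m1(2) d(1) Cd]) (auto simp: nonneg_tensor_def)
  also have "\<dots> = (s + e) * X" using m by (simp add: X_def power_even_abs)
  finally have CX: "(\<Sum>xs\<in>idx m n. C xs * prod_list (map x xs)) \<le> (s + e) * X" .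
  have UX: "(\<Sum>xs\<in>idx m n. unit_tensor xs * prod_list (map x xs)) = X"
    using form_eq_of_eigenvector[OF m1(1), of n unit_tensor x 1] by (simp add: tapply_unit_tensor X_def)
  have "lam * X = (\<Sum>xs\<in>idx m n. A xs * prod_list (map x xs))"
    using form_eq_of_eigenvector[OF m1(1) eig] by (simp add: X_def)
  also have "\<dots> = s * (\<Sum>xs\<in>idx m n. unit_tensor xs * prod_list (map x xs))
      - (\<Sum>xs\<in>idx m n. C xs * prod_list (map x xs)) + (\<Sum>xs\<in>idx m n. Min (b ` set xs) * prod_list (map x xs))"
    unfolding sum_distrib_left sum_subtractf[symmetric] sum.distrib[symmetric]
    by (intro sum.cong refl) (simp add: C_def algebra_simps)
  also have "\<dots> \<ge> s * X - (s + e) * X"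
    using min_form_nonneg[OF m(1) m1(2), of n b x] beta_MB_nonneg CX UX by (simp add: b_def)
  finally have "0 \<le> (lam + e) * X" by (simp add: algebra_simps)
  then show ?thesis using X by (simp add: zero_le_mult_iff)
qed

lemma MB0_tensor_H_eigenvalue_nonneg:
  assumes sym: "is_symmetric m n A" and m: "m \<ge> 2"
    and MB: "is_MB0_tensor m n A" and lam: "is_H_eigenvalue m n A lam"
  shows "0 \<le> lam"
proof (rule field_le_epsilon)
  fix e :: real assume e: "0 < e"
  obtain s B where B: "nonneg_tensor m n B" and s: "tensor_spectral_radius m n B \<le> s"
    and eq: "\<And>xs. xs \<in> idx m n \<Longrightarrow> A xs - beta_MB m n A (hd xs) = s * unit_tensor xs - B xs"
    using MB by (auto simp: is_MB0_tensor_def is_M_tensor_def)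
  have eq': "A xs = s * unit_tensor xs - B xs + beta_MB m n A (hd xs)" if "xs \<in> idx m n" for xs
    using eq[OF that] by simp
  have *: "tensor_spectral_radius m n B < s + e" using s e by simp
  obtain d :: "nat \<Rightarrow> real" where d: "\<And>i. i < n \<Longrightarrow> 0 < d i"
    "\<And>i. i < n \<Longrightarrow> tapply m n B d i \<le> (s + e) * d i ^ (m - 1)"
    using dominating_vector_above_spectral_radius[OF B m *] by blast
  have "- e \<le> lam"
  proof (cases "even m")
    case True
    show ?thesis by (rule MB0_even_H_eigenvalue_ge[OF True m sym B eq' d lam])
  next
    case False
    show ?thesis
      by (rule MB0_odd_H_eigenvalue_ge[where b = "beta_MB m n A", OF False m B eq' beta_MB_nonneg d lam])
  qed
  then show "0 \<le> lam + e" by simp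
qed

section \<open>Hankel tensors\<close>

text \<open>With L the functional t^a |-> v_a, this is L(f g) for the polynomials of degree below
  \<open>N\<close> with coefficients \<open>f\<close> and \<open>g\<close>.\<close>

definition hform :: "nat \<Rightarrow> (nat \<Rightarrow> real) \<Rightarrow> (nat \<Rightarrow> real) \<Rightarrow> (nat \<Rightarrow> real) \<Rightarrow> real" where
  "hform N v f g = (\<Sum>i<N. \<Sum>j<N. v (i + j) * f i * g j)"

lemma hform_commute: "hform N v f g = hform N v g f"
  unfolding hform_def by (subst sum.swap) (simp add: ac_simps)

lemma hform_add_scaled:
  "hform N v (\<lambda>i. f i + t * g i) (\<lambda>i. f i + t * g i)
     = hform N v f f + 2 * t * hform N v f g + t\<^sup>2 * hform N v g g"
proof -
  have "hform N v (\<lambda>i. f i + t * g i) (\<lambda>i. f i + t * g i)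
     = hform N v f f + t * hform N v f g + t * hform N v g f + t\<^sup>2 * hform N v g g"
    by (simp add: hform_def algebra_simps sum.distrib sum_distrib_left power2_eq_square)
  then show ?thesis by (simp add: hform_commute[of N v g f])
qed

lemma hform_eq_0_of_isotropic:
  assumes psd: "\<And>y. 0 \<le> hform N v y y" and f: "hform N v f f = 0"
  shows "hform N v f g = 0"
proof (rule ccontr)
  assume b: "hform N v f g \<noteq> 0"
  \<comment> \<open>Nearly the minimiser -b/c of the quadratic in \<open>t\<close>; the added 1
    covers c = 0 and still makes the value - t^2 (c + 2), negative unless b = 0.\<close>
  define b c t where "b = hform N v f g" and "c = hform N v g g" and "t = - b / (c + 1)"
  have c: "0 \<le> c" using psd by (simp add: c_def)
  then have tc: "t * (c + 1) = - b" by (simp add: t_def)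
  have "0 \<le> 2 * t * b + t\<^sup>2 * c"
    using psd[of "\<lambda>i. f i + t * g i"] f by (simp add: hform_add_scaled b_def c_def)
  also have "2 * t * b + t\<^sup>2 * c = - (t\<^sup>2 * (c + 2))"
    using tc by algebra
  finally have "t\<^sup>2 * (c + 2) \<le> 0" by simp
  moreover have "t \<noteq> 0" using b c by (simp add: t_def b_def)
  ultimately show False using c by (simp add: mult_le_0_iff)
qed

text \<open>Bilinearity for polynomials given as sums of monomials with possibly repeated exponents,
  as arises when a power is expanded over index lists.\<close>

lemma hform_sum_delta:
  assumes fin: "finite J" and p: "\<And>a. a \<in> J \<Longrightarrow> p a < N" and q: "\<And>a. a \<in> J \<Longrightarrow> q a < N"
  shows "hform N v (\<lambda>i. \<Sum>a\<in>J. if p a = i then w a else 0) (\<lambda>j. \<Sum>b\<in>J. if q b = j then w b else 0)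
       = (\<Sum>a\<in>J. \<Sum>b\<in>J. v (p a + q b) * w a * w b)"
proof -
  have collapse: "(\<Sum>i<N. F i * (\<Sum>a\<in>J. if r a = i then w a else 0)) = (\<Sum>a\<in>J. F (r a) * w a)"
    if "\<And>a. a \<in> J \<Longrightarrow> r a < N" for F r
  proof -
    have "(\<Sum>i<N. F i * (\<Sum>a\<in>J. if r a = i then w a else 0))
        = (\<Sum>a\<in>J. \<Sum>i<N. if r a = i then F i * w a else 0)"
      by (subst sum.swap) (simp add: sum_distrib_left if_distrib cong: if_cong)
    also have "\<dots> = (\<Sum>a\<in>J. F (r a) * w a)"
      using that by (intro sum.cong) (auto simp: sum.delta')
    finally show ?thesis .
  qed
  have "hform N v (\<lambda>i. \<Sum>a\<in>J. if p a = i then w a else 0) (\<lambda>j. \<Sum>b\<in>J. if q b = j then w b else 0)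
      = (\<Sum>i<N. (\<Sum>j<N. v (i + j) * (\<Sum>b\<in>J. if q b = j then w b else 0))
          * (\<Sum>a\<in>J. if p a = i then w a else 0))"
    unfolding hform_def sum_distrib_right by (intro sum.cong refl) (simp add: ac_simps)
  also have "\<dots> = (\<Sum>i<N. (\<Sum>b\<in>J. v (i + q b) * w b) * (\<Sum>a\<in>J. if p a = i then w a else 0))"
    using collapse[of q, OF q] by simp
  also have "\<dots> = (\<Sum>a\<in>J. (\<Sum>b\<in>J. v (p a + q b) * w b) * w a)"
    by (rule collapse[OF p])
  also have "\<dots> = (\<Sum>a\<in>J. \<Sum>b\<in>J. v (p a + q b) * w a * w b)"
    by (simp add: sum_distrib_left sum_distrib_right ac_simps)
  finally show ?thesis .
qed

text \<open>The coefficients of \<open>t^c * (\<Sum>i<n. x i * t^i)^k\<close>.\<close>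
definition power_coeffs :: "nat \<Rightarrow> nat \<Rightarrow> (nat \<Rightarrow> real) \<Rightarrow> nat \<Rightarrow> nat \<Rightarrow> real" where
  "power_coeffs k n x c a = (\<Sum>js\<in>idx k n. if c + sum_list js = a then prod_list (map x js) else 0)"

lemma sum_list_idx_le:
  assumes "js \<in> idx k n"
  shows "sum_list js \<le> (n - 1) * k"
proof -
  have "sum_list js \<le> (n - 1) * length js" if "set js \<subseteq> {..<n}" for js
    using that by (induction js) auto
  then show ?thesis using assms by (auto simp: idx_def)
qed

text \<open>Both sides are L(t^(c+d) P^(2k)) with P = sum of x_i t^i: multiplying two expansions of
  P^k concatenates their index lists. The assumptions keep both degrees below
  \<open>N\<close>.\<close>

lemma hform_power_coeffs:
  assumes "c + (n - 1) * k < N" "d + (n - 1) * k < N"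
  shows "hform N v (power_coeffs k n x c) (power_coeffs k n x d)
       = (\<Sum>xs\<in>idx (k + k) n. v (c + d + sum_list xs) * prod_list (map x xs))"
proof -
  have "hform N v (power_coeffs k n x c) (power_coeffs k n x d)
      = (\<Sum>js\<in>idx k n. \<Sum>ls\<in>idx k n. v ((c + sum_list js) + (d + sum_list ls))
           * prod_list (map x js) * prod_list (map x ls))"
    unfolding power_coeffs_def[abs_def]
  proof (rule hform_sum_delta)
    fix js assume "js \<in> idx k n"
    then show "c + sum_list js < N" "d + sum_list js < N"
      using sum_list_idx_le[of js k n] assms by simp_all
  qed simp
  also have "\<dots> = (\<Sum>xs\<in>idx (k + k) n. v (c + d + sum_list xs) * prod_list (map x xs))"
    by (simp add: sum_idx_add ac_simps)
  finally show ?thesis .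
qed

text \<open>The form A x^m is L(P^(2k)), the value of L on the square of P^k, whose degree is at
  most (n-1)k = N - 1.\<close>

lemma strong_Hankel_even_H_eigenvalue_nonneg:
  assumes m: "m = k + k" "k \<ge> 1" and gen: "hankel_generator m n A v"
    and N: "N = ((n - 1) * m + 3) div 2" and psd: "\<And>y. 0 \<le> hform N v y y"
    and lam: "is_H_eigenvalue m n A lam"
  shows "0 \<le> lam"
proof -
  obtain x j where x: "j < n" "x j \<noteq> (0::real)"
    and eig: "\<And>i. i < n \<Longrightarrow> tapply m n A x i = lam * x i ^ (m - 1)"
    using lam by (auto simp: is_H_eigenvalue_def)
  have "0 + (n - 1) * k < N" by (simp add: N m(1) algebra_simps)
  then have "(\<Sum>xs\<in>idx m n. v (sum_list xs) * prod_list (map x xs))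
      = hform N v (power_coeffs k n x 0) (power_coeffs k n x 0)"
    by (simp add: hform_power_coeffs m(1))
  moreover have "(\<Sum>xs\<in>idx m n. A xs * prod_list (map x xs)) = lam * (\<Sum>i<n. x i ^ m)"
    using m by (intro form_eq_of_eigenvector eig) auto
  ultimately have "0 \<le> lam * (\<Sum>i<n. x i ^ m)"
    using gen psd[of "power_coeffs k n x 0"] by (simp add: hankel_generator_def)
  moreover have "0 < (\<Sum>i<n. x i ^ m)"
    using m(1) x by (intro sum_even_power_pos[of m j]) auto
  ultimately show ?thesis by (simp add: zero_le_mult_iff)
qed

text \<open>Let \<open>L\<close> be the functional \<open>t^a \<mapsto> v a\<close>, \<open>P = (\<Sum>i<n. x i * t^i)\<close> and \<open>Q = P^k\<close>. Component \<open>i\<close> of the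
  eigenvalue equation reads \<open>L (t^i * Q\<^sup>2) = lam * x i^(2*k)\<close>. For even \<open>i\<close> the left side is a square, so
  \<open>lam < 0\<close> makes both sides vanish; for odd \<open>i\<close> it is a product of an isotropic vector with another
  vector, hence zero by Cauchy-Schwarz.\<close>
lemma strong_Hankel_odd_H_eigenvalue_nonneg:
  assumes m: "m = Suc (k + k)" "k \<ge> 1" and gen: "hankel_generator m n A v"
    and N: "N = ((n - 1) * m + 3) div 2" and psd: "\<And>y. 0 \<le> hform N v y y"
    and lam: "is_H_eigenvalue m n A lam"
  shows "0 \<le> lam"
proof (rule ccontr)
  assume neg: "\<not> 0 \<le> lam"
  obtain x j where x: "j < n" "x j \<noteq> (0::real)"
    and eig: "\<And>i. i < n \<Longrightarrow> tapply m n A x i = lam * x i ^ (m - 1)"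
    using lam by (auto simp: is_H_eigenvalue_def)
  define y where "y c = power_coeffs k n x c" for c
  have "2 * N + 1 \<ge> (n - 1) * m + 3" unfolding N by linarith
  \<comment> \<open>This leaves room for t^(c+1) P^k as well. For odd i = n - 1 its degree bound is
    exactly N - 1, so the matrix must reach the additional entry v_((n-1)m+1).\<close>
  then have N': "(n - 1) + 2 * ((n - 1) * k) + 3 \<le> 2 * N + 1"
    by (simp add: m(1) algebra_simps)
  have form: "hform N v (y c) (y d) = lam * x (c + d) ^ (k + k)"
    if "c + d < n" "c \<le> d" "d \<le> c + 1" for c d
  proof -
    have "c + (n - 1) * k < N" "d + (n - 1) * k < N" using that N' by linarith+
    then have "hform N v (y c) (y d)
        = (\<Sum>xs\<in>idx (k + k) n. v (c + d + sum_list xs) * prod_list (map x xs))"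
      unfolding y_def by (rule hform_power_coeffs)
    also have "\<dots> = tapply m n A x (c + d)"
      using gen that by (simp add: tapply_real hankel_generator_def m(1))
    also have "\<dots> = lam * x (c + d) ^ (k + k)" using eig[OF that(1)] by (simp add: m(1))
    finally show ?thesis .
  qed
  have even0: "hform N v (y c) (y c) = 0" if "c + c < n" for c
  proof -
    have "0 \<le> x (c + c) ^ (k + k)" by (rule zero_le_even_power) simp
    then have "lam * x (c + c) ^ (k + k) \<le> 0" using neg by (simp add: mult_le_0_iff)
    then show ?thesis using psd[of "y c"] form[OF that] by simp
  qed
  have "x i = 0" if i: "i < n" for i
  proof (cases "even i")
    case True
    then obtain c where c: "i = c + c" by (metis evenE mult_2)
    then have "lam * x i ^ (k + k) = 0" using form[of c c] even0[of c] i by simp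
    then show ?thesis using neg by simp
  next
    case False
    then obtain c where c: "i = c + (c + 1)" by (metis oddE mult_2 add.assoc)
    have "hform N v (y c) (y (c + 1)) = 0"
      by (rule hform_eq_0_of_isotropic[OF psd even0]) (use c i in simp)
    then have "lam * x i ^ (k + k) = 0" using form[of c "c + 1"] c i by simp
    then show ?thesis using neg by simp
  qed
  then show False using x by blast
qed

lemma strong_Hankel_H_eigenvalue_nonneg:
  assumes m: "m \<ge> 2" and A: "strong_Hankel m n A" and lam: "is_H_eigenvalue m n A lam"
  shows "0 \<le> lam"
proof -
  define N where "N = ((n - 1) * m + 3) div 2"
  obtain v where gen: "hankel_generator m n A v" and psd: "\<And>y. 0 \<le> hform N v y y"
    using A by (auto simp: strong_Hankel_def hform_def Let_def N_def)
  show ?thesis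
  proof (cases "even m")
    case True
    then obtain k where "m = k + k" by (metis evenE mult_2)
    then show ?thesis
      using strong_Hankel_even_H_eigenvalue_nonneg[OF _ _ gen N_def psd lam] m by simp
  next
    case False
    then obtain k where "m = Suc (k + k)" by (metis oddE mult_2 Suc_eq_plus1)
    then show ?thesis
      using strong_Hankel_odd_H_eigenvalue_nonneg[OF _ _ gen N_def psd lam] m by simp
  qed
qed

text \<open>The generator is the moment sequence of the measure with mass \<alpha>_k at \<xi>_k,
  which also supplies the additional entry. Its Hankel form is the sum of \<alpha>_k y(\<xi>_k)^2,
  with \<open>y\<close> read as a polynomial.\<close>

lemma complete_Hankel_imp_strong_Hankel:
  assumes "complete_Hankel m n A"
  shows "strong_Hankel m n A"
proof -
  obtain r :: nat and \<alpha> \<xi> :: "nat \<Rightarrow> real" where \<alpha>: "\<And>k. k < r \<Longrightarrow> 0 < \<alpha> k"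
    and A: "\<And>xs. xs \<in> idx m n \<Longrightarrow> A xs = (\<Sum>k<r. \<alpha> k * prod_list (map (\<lambda>i. \<xi> k ^ i) xs))"
    using assms unfolding complete_Hankel_def by blast
  define v where "v a = (\<Sum>k<r. \<alpha> k * \<xi> k ^ a)" for a
  have "prod_list (map (\<lambda>i. z ^ i) xs) = z ^ sum_list xs" for z :: real and xs
    by (induction xs) (simp_all add: power_add)
  then have "hankel_generator m n A v" by (simp add: hankel_generator_def A v_def)
  moreover have "0 \<le> (\<Sum>i<N. \<Sum>j<N. v (i + j) * y i * y j)" for N and y :: "nat \<Rightarrow> real"
  proof -
    have "(\<Sum>i<N. \<Sum>j<N. v (i + j) * y i * y j)
        = (\<Sum>i<N. \<Sum>j<N. \<Sum>k<r. \<alpha> k * ((\<xi> k ^ i * y i) * (\<xi> k ^ j * y j)))"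
      by (simp add: v_def sum_distrib_left sum_distrib_right power_add ac_simps)
    also have "\<dots> = (\<Sum>i<N. \<Sum>k<r. \<Sum>j<N. \<alpha> k * ((\<xi> k ^ i * y i) * (\<xi> k ^ j * y j)))"
      by (intro sum.cong refl sum.swap)
    also have "\<dots> = (\<Sum>k<r. \<Sum>i<N. \<Sum>j<N. \<alpha> k * ((\<xi> k ^ i * y i) * (\<xi> k ^ j * y j)))"
      by (rule sum.swap)
    also have "\<dots> = (\<Sum>k<r. \<alpha> k * (\<Sum>i<N. \<xi> k ^ i * y i)\<^sup>2)"
      unfolding power2_eq_square sum_product by (simp add: sum_distrib_left)
    also have "\<dots> \<ge> 0" using \<alpha> by (intro sum_nonneg mult_nonneg_nonneg) (auto intro: less_imp_le)
    finally show ?thesis .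
  qed
  ultimately show ?thesis by (auto simp: strong_Hankel_def Let_def)
qed

section \<open>Signless Laplacians\<close>

text \<open>An index tail that completes \<open>i\<close> to \<open>e\<close> has only m - 1 places
  for the m - 1 other vertices, so it is an ordering of \<open>e - {i}\<close>.\<close>

lemma card_idx_edge_le:
  assumes "card e = m" "m \<ge> 1" "i \<in> e"
  shows "card {js \<in> idx (m - 1) n. insert i (set js) = e} \<le> fact (m - 1)"
proof -
  have fe: "finite e" using assms by (metis card.infinite not_one_le_zero)
  have "{js \<in> idx (m - 1) n. insert i (set js) = e} \<subseteq> permutations_of_set (e - {i})"
  proof
    fix js assume "js \<in> {js \<in> idx (m - 1) n. insert i (set js) = e}"
    then have js: "length js = m - 1" "insert i (set js) = e" by (auto simp: idx_def)
    have i: "i \<notin> set js"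
    proof
      assume "i \<in> set js"
      then have "card e \<le> m - 1" using js card_length[of js] by (simp add: insert_absorb)
      then show False using assms by simp
    qed
    then have "set js = e - {i}" using js by blast
    moreover have "card (set js) = length js"
      using js i assms(1) card_insert_disjoint[of "set js" i] by simp
    then have "distinct js" by (rule card_distinct)
    ultimately show "js \<in> permutations_of_set (e - {i})" by (auto simp: permutations_of_set_def)
  qed
  then have "card {js \<in> idx (m - 1) n. insert i (set js) = e} \<le> card (permutations_of_set (e - {i}))"
    by (intro card_mono finite_permutations_of_set)
  also have "\<dots> = fact (m - 1)" using assms fe by simp
  finally show ?thesis .
qed

text \<open>Each edge through \<open>i\<close> accounts for at most (m-1)! off-diagonal entries
  1/(m-1)! in row \<open>i\<close>, hence for at most 1, and the diagonal entry counts these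
  edges.\<close>

lemma signless_laplacian_diagonally_dominant:
  assumes m: "m \<ge> 2" and A: "is_signless_laplacian_of_hypergraph m n A"
  shows "diagonally_dominant m n A"
  unfolding diagonally_dominant_def
proof (intro allI impI)
  fix i assume i: "i < n"
  obtain E where E: "\<And>e. e \<in> E \<Longrightarrow> e \<subseteq> {..<n} \<and> card e = m"
    and eq: "\<And>xs. xs \<in> idx m n \<Longrightarrow> A xs = signless_laplacian m E xs"
    using A by (auto simp: is_signless_laplacian_of_hypergraph_def uniform_hypergraph_def)
  define Ei where "Ei = {e \<in> E. i \<in> e}"
  have "E \<subseteq> Pow {..<n}" using E by auto
  then have fE: "finite Ei" unfolding Ei_def by (rule finite_subset[OF subset_trans[rotated]]) auto
  define w :: real where "w = 1 / fact (m - 1)"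
  have w0: "0 \<le> w" by (simp add: w_def)
  \<comment> \<open>Writing the entry as a sum over edges, with at most one nonzero term, allows the
    row sum to be reordered edge by edge.\<close>
  have off: "\<bar>A (i # js)\<bar> = (\<Sum>e\<in>Ei. if insert i (set js) = e then w else 0)"
    if js: "js \<in> idx (m - 1) n - {replicate (m - 1) i}" for js
  proof -
    have "i # js \<in> idx m n" using Cons_in_idx_iff[of i js "m - 1" n] js i m by simp
    moreover have "\<not> is_diag_index (i # js)" using js by (auto simp: is_diag_index_Cons length_idx)
    ultimately have "A (i # js) = (if insert i (set js) \<in> E then w else 0)"
      by (simp add: eq signless_laplacian_def w_def)
    then show ?thesis using fE w0 by (simp add: Ei_def)
  qed
  have "(\<Sum>js\<in>idx (m - 1) n - {replicate (m - 1) i}. \<bar>A (i # js)\<bar>)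
      = (\<Sum>js\<in>idx (m - 1) n - {replicate (m - 1) i}. \<Sum>e\<in>Ei. if insert i (set js) = e then w else 0)"
    by (intro sum.cong refl off)
  also have "\<dots> \<le> (\<Sum>js\<in>idx (m - 1) n. \<Sum>e\<in>Ei. if insert i (set js) = e then w else 0)"
    using w0 by (intro sum_mono2) (auto intro!: sum_nonneg)
  also have "\<dots> = (\<Sum>e\<in>Ei. \<Sum>js\<in>idx (m - 1) n. if insert i (set js) = e then w else 0)"
    by (rule sum.swap)
  also have "\<dots> = (\<Sum>e\<in>Ei. w * real (card {js \<in> idx (m - 1) n. insert i (set js) = e}))"
    by (simp add: sum.If_cases Int_def ac_simps)
  also have "\<dots> \<le> (\<Sum>e\<in>Ei. w * fact (m - 1))"
  proof (intro sum_mono mult_left_mono w0)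
    fix e assume "e \<in> Ei"
    then have "card {js \<in> idx (m - 1) n. insert i (set js) = e} \<le> fact (m - 1)"
      using E m by (intro card_idx_edge_le) (auto simp: Ei_def)
    then have "real (card {js \<in> idx (m - 1) n. insert i (set js) = e}) \<le> real (fact (m - 1))"
      by (rule of_nat_mono)
    then show "real (card {js \<in> idx (m - 1) n. insert i (set js) = e}) \<le> fact (m - 1)"
      by (simp only: of_nat_fact)
  qed
  also have "\<dots> = real (hyper_degree E i)" by (simp add: w_def hyper_degree_def Ei_def)
  also have "\<dots> \<le> A (replicate m i)"
  proof -
    have "is_diag_index (replicate m i)" "hd (replicate m i) = i"
      using m hd_replicate[of m i] by (auto simp: is_diag_index_iff)
    then show ?thesis
      using eq[OF replicate_in_idx[OF i]] by (simp add: signless_laplacian_def)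
  qed
  finally show "(\<Sum>js\<in>idx (m - 1) n - {replicate (m - 1) i}. \<bar>A (i # js)\<bar>) \<le> \<bar>A (replicate m i)\<bar>"
    by simp
qed

theorem mainTheorem2:
  fixes m n :: nat and A :: tensor
  assumes "m \<ge> 2"
    and "is_symmetric m n A"
    and "nonneg_tensor m n A"
    and "diagonally_dominant m n A \<or> gen_diagonally_dominant m n A \<or> is_H_tensor m n A \<or>
         complete_Hankel m n A \<or> strong_Hankel m n A \<or> is_MB0_tensor m n A \<or>
         is_signless_laplacian_of_hypergraph m n A"
  shows "doubly_nonnegative m n A"
proof -
  have "gen_diagonally_dominant m n A \<or> is_H_tensor m n A \<or> strong_Hankel m n A \<or> is_MB0_tensor m n A"
    using assms(4) diagonally_dominant_imp_gen complete_Hankel_imp_strong_Hankel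
      signless_laplacian_diagonally_dominant[OF assms(1)] by blast
  moreover have "m \<ge> 1" using assms(1) by simp
  ultimately have "0 \<le> lam" if "is_H_eigenvalue m n A lam" for lam
    using that assms(1-3) gen_diagonally_dominant_H_eigenvalue_nonneg H_tensor_H_eigenvalue_nonneg
      strong_Hankel_H_eigenvalue_nonneg MB0_tensor_H_eigenvalue_nonneg by blast
  then show ?thesis using assms(2,3) by (simp add: doubly_nonnegative_def)
qed

end
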